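(* Let $(G,P)$ be a lattice ordered group and let $T:P\to\mathcal{B}(\mathcal{H})$ be a contractive representation. If $T$ is column contractive, then $T$ is right regular. If $T$ is row contractive, then $T$ is left regular.
   Context: A lattice ordered group $(G,P)$ is a (not necessarily abelian) group $G$ with identity $e$ together with a subsemigroup $P\subseteq G$ containing $e$ such that $PP^{-1}=G$, $P\cap P^{-1}=\{e\}$, $gPg^{-1}\subseteq P$ for all $g\in G$, and such that, for the partial order $x\le y\iff x^{-1}y\in P$, any two elements $x,y\in G$ have a least upper bound $x\vee y$ and a greatest lower bound $x\wedge y$. Every $g\in G$ is uniquely written $g=g_+g_-^{-1}$ with $g_+,g_-\in P$ and $g_+\wedge g_-=e$; namely $g_+=g\vee e$, $g_-=g^{-1}\vee e$. $\mathcal{H}$ is a Hilbert space. A representation $T:P\to\mathcal{B}(\mathcal{H})$ is a unital semigroup homomorphism ($T(e)=I$, $T(pq)=T(p)T(q)$); it is contractive if $\|T(p)\|\le 1$ for all $p\in P$. A contractive representation $T$ is row contractive if $\sum_{i=1}^nT(p_i)T(p_i)^*\le I$ for all $n$ and all $p_1,\dots,p_n\in P$ with $p_i\ne e$ for all $i$ and $p_i\wedge p_j=e$ for all $i\ne j$; it is column contractive if $\sum_{i=1}^nT(p_i)^*T(p_i)\le I$ for all such $p_1,\dots,p_n$. A unital map $S:G\to\mathcal{B}(\mathcal{H})$ is completely positive definite if $[S(g_i^{-1}g_j)]_{1\le i,j\le n}\ge 0$ for all $n$ and all $g_1,\dots,g_n\in G$ ($i$ row index, $j$ column index). $T$ is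 right regular if $\tilde T(g)=T(g_-)^*T(g_+)$ is completely positive definite on $G$, and left regular if $\overline T(g)=T(g_+)T(g_-)^*$ is completely positive definite on $G$. *)

theory Defs
  imports "HOL-Analysis.Analysis" "HOL-Algebra.Coset"
begin

section \<open>Complex Hilbert spaces\<close>

text \<open>
  Complex Hilbert spaces over the library's real Banach spaces. The inner product is linear in its
  first argument; positive definiteness is the last axiom, which ties it to the norm.
\<close>

class complex_hilbert_space = banach +
  fixes scaleC :: "complex \<Rightarrow> 'a \<Rightarrow> 'a"  (infixr \<open>*\<^sub>C\<close> 75)
    and cinner :: "'a \<Rightarrow> 'a \<Rightarrow> complex"
  assumes scaleC_add_right: "a *\<^sub>C (x + y) = a *\<^sub>C x + a *\<^sub>C y"
    and scaleC_add_left: "(a + b) *\<^sub>C x = a *\<^sub>C x + b *\<^sub>C x"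
    and scaleC_scaleC: "a *\<^sub>C b *\<^sub>C x = (a * b) *\<^sub>C x"
    and scaleC_of_real: "complex_of_real r *\<^sub>C x = r *\<^sub>R x"
    and cinner_commute: "cinner x y = cnj (cinner y x)"
    and cinner_add_left: "cinner (x + y) z = cinner x z + cinner y z"
    and cinner_scaleC_left: "cinner (a *\<^sub>C x) y = a * cinner x y"
    and cinner_norm_sq: "cinner x x = complex_of_real ((norm x)\<^sup>2)"

text \<open>
  The type of bounded linear operators of the library is that of the real-linear ones (with the
  operator norm), hence \<open>B(H)\<close> is the following subset.
\<close>

definition bounded_operators :: "('h::complex_hilbert_space \<Rightarrow>\<^sub>L 'h) set" where
  "bounded_operators = {A. \<forall>c x. blinfun_apply A (c *\<^sub>C x) = c *\<^sub>C blinfun_apply A x}"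

definition cadjoint :: "('h::complex_hilbert_space \<Rightarrow>\<^sub>L 'h) \<Rightarrow> ('h \<Rightarrow>\<^sub>L 'h)" where
  "cadjoint A = (THE B. \<forall>x y. cinner (blinfun_apply A x) y = cinner x (blinfun_apply B y))"

definition positive_operator :: "('h::complex_hilbert_space \<Rightarrow>\<^sub>L 'h) \<Rightarrow> bool" where
  "positive_operator A \<longleftrightarrow>
     A \<in> bounded_operators \<and> (\<forall>x. cinner (blinfun_apply A x) x \<in> \<real>\<^sub>\<ge>\<^sub>0)"

definition operator_le ::
    "('h::complex_hilbert_space \<Rightarrow>\<^sub>L 'h) \<Rightarrow> ('h \<Rightarrow>\<^sub>L 'h) \<Rightarrow> bool" where
  "operator_le A B \<longleftrightarrow> positive_operator (B - A)"

text \<open>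
  Positivity of an \<open>n \<times> n\<close> operator matrix acting on the \<open>n\<close>-fold direct sum of the Hilbert space.
  A vector of the direct sum is given by the values of a function at the indices below \<open>n\<close>; the
  sum over \<open>i\<close> is its inner product with the product of the matrix and the vector.
\<close>

definition positive_operator_matrix ::
    "nat \<Rightarrow> (nat \<Rightarrow> nat \<Rightarrow> ('h::complex_hilbert_space \<Rightarrow>\<^sub>L 'h)) \<Rightarrow> bool" where
  "positive_operator_matrix n A \<longleftrightarrow>
     (\<forall>i<n. \<forall>j<n. A i j \<in> bounded_operators) \<and>
     (\<forall>h :: nat \<Rightarrow> 'h. (\<Sum>i<n. cinner (\<Sum>j<n. blinfun_apply (A i j) (h j)) (h i)) \<in> \<real>\<^sub>\<ge>\<^sub>0)"

section \<open>Lattice ordered groups\<close>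

definition cone_order :: "('g, 'm) monoid_scheme \<Rightarrow> 'g set \<Rightarrow> 'g gorder" where
  "cone_order G P =
     \<lparr> carrier = carrier G, eq = (=), le = (\<lambda>x y. inv\<^bsub>G\<^esub> x \<otimes>\<^bsub>G\<^esub> y \<in> P) \<rparr>"

locale lattice_ordered_group = group G for G (structure) +
  fixes P
  assumes cone_subset: "P \<subseteq> carrier G"
    and cone_mult_closed: "\<lbrakk>p \<in> P; q \<in> P\<rbrakk> \<Longrightarrow> p \<otimes> q \<in> P"
    and cone_one: "\<one> \<in> P"
    and cone_generates: "P <#> (set_inv P) = carrier G"
    and cone_pointed: "P \<inter> set_inv P = {\<one>}"
    and cone_conj: "\<lbrakk>g \<in> carrier G; p \<in> P\<rbrakk> \<Longrightarrow> g \<otimes> p \<otimes> inv g \<in> P"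
    and cone_lattice: "Lattice.lattice (cone_order G P)"

definition pos_part :: "('g, 'm) monoid_scheme \<Rightarrow> 'g set \<Rightarrow> 'g \<Rightarrow> 'g" where
  "pos_part G P g = g \<squnion>\<^bsub>cone_order G P\<^esub> \<one>\<^bsub>G\<^esub>"

definition neg_part :: "('g, 'm) monoid_scheme \<Rightarrow> 'g set \<Rightarrow> 'g \<Rightarrow> 'g" where
  "neg_part G P g = inv\<^bsub>G\<^esub> g \<squnion>\<^bsub>cone_order G P\<^esub> \<one>\<^bsub>G\<^esub>"

section \<open>Representations of the positive cone\<close>

definition representation ::
    "('g, 'm) monoid_scheme \<Rightarrow> 'g set \<Rightarrow> ('g \<Rightarrow> ('h::complex_hilbert_space \<Rightarrow>\<^sub>L 'h)) \<Rightarrow> bool" where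
  "representation G P T \<longleftrightarrow>
     T \<in> P \<rightarrow> bounded_operators \<and> T \<one>\<^bsub>G\<^esub> = id_blinfun \<and>
     (\<forall>p\<in>P. \<forall>q\<in>P. T (p \<otimes>\<^bsub>G\<^esub> q) = T p o\<^sub>L T q)"

definition contractive_representation ::
    "('g, 'm) monoid_scheme \<Rightarrow> 'g set \<Rightarrow> ('g \<Rightarrow> ('h::complex_hilbert_space \<Rightarrow>\<^sub>L 'h)) \<Rightarrow> bool" where
  "contractive_representation G P T \<longleftrightarrow> representation G P T \<and> (\<forall>p\<in>P. norm (T p) \<le> 1)"

definition orthogonal_family ::
    "('g, 'm) monoid_scheme \<Rightarrow> 'g set \<Rightarrow> nat \<Rightarrow> (nat \<Rightarrow> 'g) \<Rightarrow> bool" where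
  "orthogonal_family G P n p \<longleftrightarrow>
     (\<forall>i<n. p i \<in> P \<and> p i \<noteq> \<one>\<^bsub>G\<^esub>) \<and>
     (\<forall>i<n. \<forall>j<n. i \<noteq> j \<longrightarrow> p i \<sqinter>\<^bsub>cone_order G P\<^esub> p j = \<one>\<^bsub>G\<^esub>)"

definition row_contractive ::
    "('g, 'm) monoid_scheme \<Rightarrow> 'g set \<Rightarrow> ('g \<Rightarrow> ('h::complex_hilbert_space \<Rightarrow>\<^sub>L 'h)) \<Rightarrow> bool" where
  "row_contractive G P T \<longleftrightarrow>
     (\<forall>n p. orthogonal_family G P n p \<longrightarrow>
        operator_le (\<Sum>i<n. T (p i) o\<^sub>L cadjoint (T (p i))) id_blinfun)"

definition column_contractive ::
    "('g, 'm) monoid_scheme \<Rightarrow> 'g set \<Rightarrow> ('g \<Rightarrow> ('h::complex_hilbert_space \<Rightarrow>\<^sub>L 'h)) \<Rightarrow> bool" where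
  "column_contractive G P T \<longleftrightarrow>
     (\<forall>n p. orthogonal_family G P n p \<longrightarrow>
        operator_le (\<Sum>i<n. cadjoint (T (p i)) o\<^sub>L T (p i)) id_blinfun)"

definition completely_positive_definite ::
    "('g, 'm) monoid_scheme \<Rightarrow> ('g \<Rightarrow> ('h::complex_hilbert_space \<Rightarrow>\<^sub>L 'h)) \<Rightarrow> bool" where
  "completely_positive_definite G S \<longleftrightarrow>
     S \<in> carrier G \<rightarrow> bounded_operators \<and> S \<one>\<^bsub>G\<^esub> = id_blinfun \<and>
     (\<forall>n g. (\<forall>i<n. g i \<in> carrier G) \<longrightarrow>
        positive_operator_matrix n (\<lambda>i j. S (inv\<^bsub>G\<^esub> (g i) \<otimes>\<^bsub>G\<^esub> g j)))"

definition right_regular ::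
    "('g, 'm) monoid_scheme \<Rightarrow> 'g set \<Rightarrow> ('g \<Rightarrow> ('h::complex_hilbert_space \<Rightarrow>\<^sub>L 'h)) \<Rightarrow> bool" where
  "right_regular G P T \<longleftrightarrow>
     completely_positive_definite G
       (\<lambda>g. cadjoint (T (neg_part G P g)) o\<^sub>L T (pos_part G P g))"

definition left_regular ::
    "('g, 'm) monoid_scheme \<Rightarrow> 'g set \<Rightarrow> ('g \<Rightarrow> ('h::complex_hilbert_space \<Rightarrow>\<^sub>L 'h)) \<Rightarrow> bool" where
  "left_regular G P T \<longleftrightarrow>
     completely_positive_definite G
       (\<lambda>g. T (pos_part G P g) o\<^sub>L cadjoint (T (neg_part G P g)))"

end

theory Submission
  imports Defs
begin

text \<open>
  Fix \<open>g\<^sub>1, \<dots>, g\<^sub>n\<close> in \<open>G\<close>. For \<open>p, q\<close> in \<open>G\<close> the positive and negative parts of \<open>p\<^sup>-\<^sup>1 q\<close> are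
  \<open>(p \<and> q)\<^sup>-\<^sup>1 q\<close> and \<open>(p \<and> q)\<^sup>-\<^sup>1 p\<close>. Hence, writing \<open>A r s = T(r\<^sup>-\<^sup>1 s)\<close> for \<open>r \<le> s\<close>, right regularity says
  that the quadratic forms
  \[ \sum_{i,j} \langle A(g_i \wedge g_j, g_j) h_j,\, A(g_i \wedge g_j, g_i) h_i \rangle \]
  are nonnegative. The operators satisfy \<open>A r s \<circ> A s t = A r t\<close>, and elements \<open>x\<^sub>i < s\<close> with
  pairwise join \<open>s\<close> yield pairwise orthogonal \<open>x\<^sub>i\<^sup>-\<^sup>1 s\<close>, so that column contractivity bounds the
  sum of the \<open>\<parallel>A x\<^sub>i s v\<parallel>\<^sup>2\<close> by \<open>\<parallel>v\<parallel>\<^sup>2\<close>.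

  From here on only the order matters. A lattice ordered group is a distributive lattice, so the
  \<open>g\<^sub>i\<close> lie in a finite distributive sublattice. Each inner product in the quadratic form depends on the
  pair \<open>(i, j)\<close> through the meet \<open>g\<^sub>i \<and> g\<^sub>j\<close>; Moebius inversion (\<open>Moebius_inversion_lower_covers\<close>)
  replaces this constraint by a sum over all common lower bounds \<open>s\<close>, and the form becomes a sum over
  \<open>s\<close> of alternating sums of squares of norms, indexed by the sets of lower covers of \<open>s\<close>. Distinct
  lower covers of \<open>s\<close> have join \<open>s\<close>, so these alternating sums are the expressions of Brehmer's
  condition for pairwise orthogonal elements; they are nonnegative by column contractivity
  (\<open>alternating_sum_nonneg\<close>). This is \<open>kernel_nonneg\<close>.

  The second claim is the same statement for the dual lattice. Now the positive and negative
  parts of \<open>p\<^sup>-\<^sup>1 q\<close> are written as \<open>p\<^sup>-\<^sup>1 (p \<or> q)\<close> and \<open>q\<^sup>-\<^sup>1 (p \<or> q)\<close>, and the operators are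
  \<open>A r s = T(s\<^sup>-\<^sup>1 r)\<^sup>*\<close> for \<open>s \<le> r\<close>.

  Adjoints are given by a definite description, so their existence has to be proved; it follows
  from the representation of bounded functionals, by minimisation (\<open>Riesz_real_part\<close>).
\<close>

section \<open>Complex inner products and adjoints\<close>

lemma cinner_zero_left [simp]: "cinner 0 (y::'h::complex_hilbert_space) = 0"
  using cinner_add_left[of 0 0 y] by simp

lemma cinner_add_right: "cinner (x::'h::complex_hilbert_space) (y + z) = cinner x y + cinner x z"
  by (metis cinner_add_left cinner_commute complex_cnj_add)

lemma cinner_zero_right [simp]: "cinner (x::'h::complex_hilbert_space) 0 = 0"
  using cinner_add_right[of x 0 0] by simp

lemma cinner_minus_left: "cinner (- x) (y::'h::complex_hilbert_space) = - cinner x y"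
  using cinner_add_left[of x "- x" y] by (simp add: eq_neg_iff_add_eq_0 add.commute)

lemma cinner_diff_left: "cinner (x - z) (y::'h::complex_hilbert_space) = cinner x y - cinner z y"
  using cinner_add_left[of x "- z" y] by (simp add: cinner_minus_left)

lemma cinner_diff_right: "cinner (x::'h::complex_hilbert_space) (y - z) = cinner x y - cinner x z"
  by (metis cinner_diff_left cinner_commute complex_cnj_diff)

lemma cinner_scaleC_right: "cinner (x::'h::complex_hilbert_space) (a *\<^sub>C y) = cnj a * cinner x y"
  by (metis cinner_scaleC_left cinner_commute complex_cnj_mult)

lemma cinner_scaleR_left: "cinner (r *\<^sub>R x) (y::'h::complex_hilbert_space) = of_real r * cinner x y"
  by (metis cinner_scaleC_left scaleC_of_real)

lemma cinner_scaleR_right: "cinner x (r *\<^sub>R (y::'h::complex_hilbert_space)) = of_real r * cinner x y"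
  by (metis cinner_scaleC_right scaleC_of_real complex_cnj_complex_of_real)

lemma cinner_sum_left:
  "cinner (\<Sum>i\<in>I. x i) (y::'h::complex_hilbert_space) = (\<Sum>i\<in>I. cinner (x i) y)"
  by (induction I rule: infinite_finite_induct) (simp_all add: cinner_add_left)

lemma cinner_sum_right:
  "cinner (x::'h::complex_hilbert_space) (\<Sum>i\<in>I. y i) = (\<Sum>i\<in>I. cinner x (y i))"
  by (induction I rule: infinite_finite_induct) (simp_all add: cinner_add_right)

lemma norm_add_square:
  "(norm (x + y))\<^sup>2 = (norm x)\<^sup>2 + 2 * Re (cinner x y) + (norm (y::'h::complex_hilbert_space))\<^sup>2"
proof -
  have "complex_of_real ((norm (x + y))\<^sup>2)
      = of_real ((norm x)\<^sup>2) + (cinner x y + cnj (cinner x y)) + of_real ((norm y)\<^sup>2)"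
    using cinner_commute[of y x]
    by (simp only: cinner_norm_sq[symmetric] cinner_add_left cinner_add_right)
      (simp only: cinner_add_left cinner_add_right add_ac)
  also have "\<dots> = of_real ((norm x)\<^sup>2 + 2 * Re (cinner x y) + (norm y)\<^sup>2)"
    by (simp add: complex_add_cnj)
  finally show ?thesis by (simp only: of_real_eq_iff)
qed

lemma Re_cinner_le_norm: "Re (cinner x y) \<le> norm x * norm (y::'h::complex_hilbert_space)"
proof -
  have "(norm (x + y))\<^sup>2 \<le> (norm x + norm y)\<^sup>2"
    by (simp add: norm_triangle_ineq power_mono)
  then show ?thesis unfolding norm_add_square by (simp add: power2_sum)
qed

lemma parallelogram:
  "(norm (x + y))\<^sup>2 + (norm (x - y))\<^sup>2
    = 2 * (norm x)\<^sup>2 + 2 * (norm (y::'h::complex_hilbert_space))\<^sup>2"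
proof -
  have "cinner x (- y) = - cinner x y"
    using cinner_diff_right[of x 0 y] by simp
  then show ?thesis
    using norm_add_square[of x y] norm_add_square[of x "- y"] by simp
qed

lemma cinner_eqI:
  assumes "\<And>x. cinner x y = cinner x (z::'h::complex_hilbert_space)"
  shows "y = z"
proof -
  have "cinner (y - z) (y - z) = 0"
    using assms by (simp add: cinner_diff_right)
  then show ?thesis by (simp add: cinner_norm_sq)
qed

text \<open>
  The convexity assumption is what the parallelogram law gives for a functional that differs from
  the square of the norm by an affine one: two near minimisers are near each other.
\<close>
lemma minimising_imp_convergent:
  fixes J :: "'h::complex_hilbert_space \<Rightarrow> real"
  assumes lower: "\<And>x. m \<le> J x"
    and convex: "\<And>x y. (norm (x - y))\<^sup>2 \<le> 2 * (J x - m) + 2 * (J y - m)"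
    and X: "\<And>n. J (X n) < m + inverse (real (Suc n))"
  shows "convergent X"
proof -
  have "Cauchy X"
  proof (rule CauchyI)
    fix e :: real
    assume "0 < e"
    then obtain N where N: "inverse (real (Suc N)) < e\<^sup>2 / 4"
      using reals_Archimedean[of "e\<^sup>2 / 4"] \<open>0 < e\<close> by auto
    have "norm (X k - X l) < e" if "N \<le> k" "N \<le> l" for k l
    proof -
      have "J (X j) < m + e\<^sup>2 / 4" if "N \<le> j" for j
      proof -
        have "inverse (real (Suc j)) \<le> inverse (real (Suc N))"
          using that by (intro le_imp_inverse_le) auto
        then show ?thesis using X[of j] N by linarith
      qed
      from this[of k] this[of l] that
      have "J (X k) < m + e\<^sup>2 / 4" "J (X l) < m + e\<^sup>2 / 4" by blast+
      then have "(norm (X k - X l))\<^sup>2 < e\<^sup>2"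
        using convex[of "X k" "X l"] by simp
      then show ?thesis
        using \<open>0 < e\<close> by (simp add: power2_less_imp_less)
    qed
    then show "\<exists>M. \<forall>k\<ge>M. \<forall>l\<ge>M. norm (X k - X l) < e" by blast
  qed
  then show ?thesis by (simp add: Cauchy_convergent_iff)
qed

text \<open>
  The vector that represents \<open>\<phi>\<close> is the minimiser of \<open>J x = \<parallel>x\<parallel>\<^sup>2 - 2 \<phi>(x)\<close>, since the derivative
  of \<open>J\<close> at \<open>z\<close> in direction \<open>x\<close> is \<open>2 (Re \<langle>x, z\<rangle> - \<phi>(x))\<close>. Working with the real part only avoids
  complex-linear functionals; for the adjoint of a complex-linear operator, the imaginary part is recovered
  by replacing \<open>x\<close> with \<open>\<i> x\<close>.
\<close>
lemma Riesz_real_part: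
  fixes \<phi> :: "'h::complex_hilbert_space \<Rightarrow> real"
  assumes "bounded_linear \<phi>"
  obtains z where "\<And>x. \<phi> x = Re (cinner x z)"
proof -
  interpret \<phi>: bounded_linear \<phi> by fact
  define J where "J x = (norm x)\<^sup>2 - 2 * \<phi> x" for x
  obtain K where K: "\<And>x. norm (\<phi> x) \<le> norm x * K"
    using \<phi>.bounded by blast
  have "- (K\<^sup>2) \<le> J x" for x
  proof -
    have "0 \<le> (norm x - K)\<^sup>2" by simp
    then have "2 * (norm x * K) \<le> (norm x)\<^sup>2 + K\<^sup>2" by (simp add: power2_diff)
    then show ?thesis using K[of x] by (simp add: J_def abs_le_iff)
  qed
  then have bdd: "bdd_below (range J)" by (metis bdd_belowI2)
  define m where "m = (INF x. J x)"
  have lower: "m \<le> J x" for x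
    unfolding m_def using bdd by (simp add: cINF_lower)
  have convex: "(norm (x - y))\<^sup>2 \<le> 2 * (J x - m) + 2 * (J y - m)" for x y
  proof -
    have "m \<le> (norm ((1/2) *\<^sub>R (x + y)))\<^sup>2 - 2 * \<phi> ((1/2) *\<^sub>R (x + y))"
      using lower unfolding J_def by blast
    also have "\<dots> = (norm (x + y))\<^sup>2 / 4 - \<phi> x - \<phi> y"
      by (simp only: \<phi>.scaleR \<phi>.add norm_scaleR power_mult_distrib) (simp add: power_divide field_simps)
    finally show ?thesis
      using parallelogram[of x y] by (simp add: J_def)
  qed
  have "\<exists>x. J x < m + inverse (real (Suc n))" for n
    using cInf_lessD[of "range J" "m + inverse (real (Suc n))"] by (auto simp: m_def)
  then obtain X where X: "\<And>n. J (X n) < m + inverse (real (Suc n))" by metis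
  obtain z where z: "X \<longlonglongrightarrow> z"
    using minimising_imp_convergent[of m J X] lower convex X convergent_def by blast
  have "(\<lambda>n. J (X n)) \<longlonglongrightarrow> J z"
    unfolding J_def by (intro tendsto_intros \<phi>.tendsto z)
  moreover have "(\<lambda>n. m + inverse (real (Suc n))) \<longlonglongrightarrow> m + 0"
    by (intro tendsto_intros LIMSEQ_inverse_real_of_nat)
  ultimately have Jz: "J z \<le> m"
    using LIMSEQ_le[of "\<lambda>n. J (X n)" "J z"] X by (fastforce intro: less_imp_le)
  have "\<phi> x = Re (cinner x z)" for x
  proof -
    define d where "d = Re (cinner x z) - \<phi> x"
    have pos: "0 \<le> 2 * t * d + t\<^sup>2 * (norm x)\<^sup>2" for t
    proof -
      have "J z \<le> J (t *\<^sub>R x + z)"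
        using Jz lower order_trans by blast
      then show ?thesis
        unfolding J_def norm_add_square d_def
        by (simp add: \<phi>.add \<phi>.scaleR cinner_scaleR_left power_mult_distrib algebra_simps)
    qed
    show ?thesis
    proof (rule ccontr)
      assume "\<phi> x \<noteq> Re (cinner x z)"
      then have "d \<noteq> 0" by (simp add: d_def)
      \<comment> \<open>The quadratic polynomial in \<open>pos\<close> is negative at this \<open>t\<close>; the summand 1 only covers \<open>x = 0\<close>.\<close>
      define t where "t = - d / (1 + (norm x)\<^sup>2)"
      have t: "t * (1 + (norm x)\<^sup>2) = - d"
        by (simp add: t_def add_nonneg_eq_0_iff)
      have "t\<^sup>2 * (norm x)\<^sup>2 = t * (t * (1 + (norm x)\<^sup>2)) - t\<^sup>2"
        by (simp add: algebra_simps power2_eq_square)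
      also have "\<dots> = - t * d - t\<^sup>2" by (simp add: t)
      finally have "0 \<le> t * d - t\<^sup>2"
        using pos[of t] by (simp add: algebra_simps)
      moreover have "t * d \<le> 0"
        by (simp add: t_def divide_nonpos_pos add_pos_nonneg)
      moreover have "0 < t\<^sup>2" using t \<open>d \<noteq> 0\<close> by auto
      ultimately show False by linarith
    qed
  qed
  then show ?thesis using that by blast
qed

lemma cadjoint_exists:
  assumes A: "A \<in> bounded_operators"
  shows "\<exists>B. \<forall>x y. cinner (blinfun_apply A x) y = cinner x (blinfun_apply B y)"
proof -
  have "\<exists>z. \<forall>x. cinner (A x) y = cinner x z" for y
  proof -
    have "bounded_linear (\<lambda>x. Re (cinner (A x) y))"
    proof (rule bounded_linear_intro)
      show "norm (Re (cinner (A x) y)) \<le> norm x * (norm A * norm y)" for x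
      proof -
        have "\<bar>Re (cinner (A x) y)\<bar> \<le> norm (A x) * norm y"
          using Re_cinner_le_norm[of "A x" y] Re_cinner_le_norm[of "- A x" y]
          by (simp add: cinner_minus_left abs_le_iff)
        also have "\<dots> \<le> norm A * norm x * norm y"
          by (simp add: mult_right_mono norm_blinfun)
        finally show ?thesis by (simp add: mult_ac)
      qed
    qed (simp_all add: blinfun.add_right blinfun.scaleR_right cinner_add_left cinner_scaleR_left)
    then obtain z where z: "\<And>x. Re (cinner (A x) y) = Re (cinner x z)"
      using Riesz_real_part by blast
    have "cinner (A x) y = cinner x z" for x
    proof (rule complex_eqI)
      have "A (\<i> *\<^sub>C x) = \<i> *\<^sub>C A x" using A by (simp add: bounded_operators_def)
      then show "Im (cinner (A x) y) = Im (cinner x z)"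
        using z[of "\<i> *\<^sub>C x"] by (simp add: cinner_scaleC_left)
    qed (rule z)
    then show ?thesis by blast
  qed
  then obtain B where B: "\<And>x y. cinner (A x) y = cinner x (B y)" by metis
  have "bounded_linear B"
  proof (rule bounded_linear_intro)
    show "B (x + y) = B x + B y" for x y
      by (rule cinner_eqI) (simp add: cinner_add_right flip: B)
    show "B (r *\<^sub>R x) = r *\<^sub>R B x" for r x
      by (rule cinner_eqI) (simp add: cinner_scaleR_right flip: B)
    show "norm (B y) \<le> norm y * norm A" for y
    proof (cases "B y = 0")
      case False
      have "(norm (B y))\<^sup>2 = Re (cinner (A (B y)) y)"
        unfolding B by (simp add: cinner_norm_sq)
      also have "\<dots> \<le> norm (A (B y)) * norm y" by (rule Re_cinner_le_norm)
      also have "\<dots> \<le> norm A * norm (B y) * norm y"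
        by (simp add: mult_right_mono norm_blinfun)
      finally show ?thesis
        using False by (simp add: power2_eq_square mult_ac)
    qed simp
  qed
  then have "\<forall>x y. cinner (A x) y = cinner x (blinfun_apply (Blinfun B) y)"
    by (simp add: B bounded_linear_Blinfun_apply)
  then show ?thesis by blast
qed

text \<open>
  The adjoint is a definite description, so that any operator with the adjoint property is the
  adjoint once uniqueness is known, and uniqueness holds because only the zero vector is
  orthogonal to every vector.
\<close>
lemma cadjoint_eqI:
  assumes "\<And>x y. cinner (blinfun_apply A x) y = cinner x (blinfun_apply B y)"
  shows "cadjoint A = B"
  unfolding cadjoint_def
proof (rule the_equality)
  fix C
  assume C: "\<forall>x y. cinner (blinfun_apply A x) y = cinner x (blinfun_apply C y)"
  show "C = B"
    by (intro blinfun_eqI cinner_eqI) (metis C assms)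
qed (use assms in blast)

lemma cinner_cadjoint:
  assumes "A \<in> bounded_operators"
  shows "cinner (blinfun_apply A x) y = cinner x (blinfun_apply (cadjoint A) y)"
  using cadjoint_exists[OF assms] cadjoint_eqI by metis

lemma cinner_cadjoint_left:
  assumes "A \<in> bounded_operators"
  shows "cinner (blinfun_apply (cadjoint A) x) y = cinner x (blinfun_apply A y)"
  by (metis assms cinner_cadjoint cinner_commute)

lemma cadjoint_bounded_operators:
  assumes "A \<in> bounded_operators"
  shows "cadjoint A \<in> bounded_operators"
proof -
  have "cadjoint A (c *\<^sub>C x) = c *\<^sub>C cadjoint A x" for c x
    by (rule cinner_eqI) (simp add: cinner_scaleC_right flip: cinner_cadjoint[OF assms])
  then show ?thesis by (simp add: bounded_operators_def)
qed

lemma compose_bounded_operators: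
  assumes "A \<in> bounded_operators" "B \<in> bounded_operators"
  shows "A o\<^sub>L B \<in> bounded_operators"
  using assms by (simp add: bounded_operators_def)

lemma cadjoint_compose:
  assumes "A \<in> bounded_operators" "B \<in> bounded_operators"
  shows "cadjoint (A o\<^sub>L B) = cadjoint B o\<^sub>L cadjoint A"
  by (rule cadjoint_eqI) (simp add: assms cinner_cadjoint)

lemma cadjoint_id: "cadjoint id_blinfun = id_blinfun"
  by (rule cadjoint_eqI) simp

lemma sum_operator_le_id_imp_norm:
  assumes "operator_le (\<Sum>i<(n::nat). cadjoint (A i) o\<^sub>L A i) id_blinfun"
    and "\<And>i. i < n \<Longrightarrow> A i \<in> bounded_operators"
  shows "(\<Sum>i<n. (norm (blinfun_apply (A i) x))\<^sup>2) \<le> (norm x)\<^sup>2"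
proof -
  have "cinner ((id_blinfun - (\<Sum>i<n. cadjoint (A i) o\<^sub>L A i)) x) x
      = of_real ((norm x)\<^sup>2 - (\<Sum>i<n. (norm (A i x))\<^sup>2))"
    using assms(2)
    by (simp add: blinfun.diff_left blinfun.sum_left cinner_diff_left cinner_sum_left
        cinner_cadjoint_left cinner_norm_sq)
  moreover have "cinner ((id_blinfun - (\<Sum>i<n. cadjoint (A i) o\<^sub>L A i)) x) x \<in> \<real>\<^sub>\<ge>\<^sub>0"
    using assms(1) by (simp add: operator_le_def positive_operator_def)
  ultimately show ?thesis
    by (simp only: nonneg_Reals_of_real_iff diff_ge_0_iff_ge)
qed

lemma cadjoint_cadjoint:
  assumes "A \<in> bounded_operators"
  shows "cadjoint (cadjoint A) = A"
  by (rule cadjoint_eqI) (simp add: assms cinner_cadjoint_left)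



section \<open>Alternating sums over subsets\<close>

lemma alternating_sum_insert:
  fixes f :: "'a set \<Rightarrow> 'b::comm_ring_1"
  assumes "finite C" "c \<notin> C"
  shows "(\<Sum>U\<in>Pow (insert c C). (-1) ^ card U * f U)
    = (\<Sum>U\<in>Pow C. (-1) ^ card U * (f U - f (insert c U)))"
proof -
  have "inj_on (insert c) (Pow C)" using assms(2) by (auto simp: inj_on_def)
  moreover have "Pow C \<inter> insert c ` Pow C = {}" using assms(2) by auto
  ultimately have "(\<Sum>U\<in>Pow (insert c C). (-1) ^ card U * f U)
      = (\<Sum>U\<in>Pow C. (-1) ^ card U * f U) + (\<Sum>U\<in>Pow C. (-1) ^ card (insert c U) * f (insert c U))"
    using assms(1) by (simp add: Pow_insert sum.union_disjoint sum.reindex)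
  also have "(\<Sum>U\<in>Pow C. (-1) ^ card (insert c U) * f (insert c U))
      = (\<Sum>U\<in>Pow C. - ((-1) ^ card U * f (insert c U)))"
  proof (rule sum.cong)
    fix U assume "U \<in> Pow C"
    then have "card (insert c U) = Suc (card U)"
      using assms finite_subset[of U C] by (auto simp: card_insert_if)
    then show "(-1) ^ card (insert c U) * f (insert c U) = - ((-1) ^ card U * f (insert c U))"
      by simp
  qed simp
  finally show ?thesis
    by (simp add: right_diff_distrib sum_subtractf sum_negf)
qed

text \<open>
  Writing \<open>S\<^sub>k\<close> for the sum of \<open>a U\<close> over the sets \<open>U\<close> with \<open>k\<close> elements, the last hypothesis says
  in essence that \<open>S\<^sub>k\<close> decreases in \<open>k\<close>, so that the alternating sum is nonnegative. The proof is an
  induction on \<open>C\<close>: splitting off an element \<open>c\<close> replaces \<open>a U\<close> by \<open>a U - a (insert c U)\<close>, and this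
  function inherits both hypotheses.

  For \<open>a U = \<parallel>T(\<Prod>U) v\<parallel>\<^sup>2\<close>, with \<open>T\<close> column contractive and \<open>C\<close> a set of pairwise
  orthogonal elements other than the identity, this is Brehmer's positivity condition.
\<close>
lemma alternating_sum_nonneg:
  fixes a :: "'a set \<Rightarrow> real"
  assumes "finite C"
    and "\<And>U. U \<subseteq> C \<Longrightarrow> 0 \<le> a U"
    and "\<And>U. U \<subseteq> C \<Longrightarrow> (\<Sum>c\<in>C - U. a (insert c U)) \<le> a U"
  shows "0 \<le> (\<Sum>U\<in>Pow C. (-1) ^ card U * a U)"
  using assms
proof (induction C arbitrary: a rule: finite_induct)
  case (insert c C)
  have le: "(\<Sum>d\<in>C - U. a (insert d U)) + a (insert c U) \<le> a U" if "U \<subseteq> C" for U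
  proof -
    have "insert c C - U = insert c (C - U)" "c \<notin> C - U"
      using that insert.hyps by auto
    then show ?thesis
      using insert.prems(2)[of U] that insert.hyps(1) by (auto simp: add.commute)
  qed
  have nonneg: "0 \<le> (\<Sum>d\<in>C - U. a (insert d U))" if "U \<subseteq> C" for U
    using that by (intro sum_nonneg insert.prems(1)) auto
  have "0 \<le> (\<Sum>U\<in>Pow C. (-1) ^ card U * (a U - a (insert c U)))"
  proof (rule insert.IH)
    fix U assume "U \<subseteq> C"
    show "0 \<le> a U - a (insert c U)"
      using le[OF \<open>U \<subseteq> C\<close>] nonneg[OF \<open>U \<subseteq> C\<close>] by simp
    have "(\<Sum>d\<in>C - U. a (insert d U) - a (insert c (insert d U))) \<le> (\<Sum>d\<in>C - U. a (insert d U))"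
    proof (rule sum_mono)
      fix d assume "d \<in> C - U"
      then have "0 \<le> a (insert c (insert d U))"
        using \<open>U \<subseteq> C\<close> by (intro insert.prems(1)) auto
      then show "a (insert d U) - a (insert c (insert d U)) \<le> a (insert d U)" by simp
    qed
    then show "(\<Sum>d\<in>C - U. a (insert d U) - a (insert c (insert d U))) \<le> a U - a (insert c U)"
      using le[OF \<open>U \<subseteq> C\<close>] by simp
  qed
  also have "\<dots> = (\<Sum>U\<in>Pow (insert c C). (-1) ^ card U * a U)"
    by (simp only: alternating_sum_insert[OF insert.hyps])
  finally show ?case .
qed simp

text \<open>
  Inclusion and exclusion in the form that is needed for Moebius inversion: the sets removed
  from \<open>X\<close> are indexed by \<open>C\<close>, and the summand at \<open>U = {}\<close> is the sum over all of \<open>X\<close>.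
\<close>
lemma sum_inclusion_exclusion:
  fixes g :: "'a \<Rightarrow> 'b::comm_ring_1"
  assumes "finite C" and "finite X"
  shows "(\<Sum>U\<in>Pow C. (-1) ^ card U * (\<Sum>s\<in>{s \<in> X. \<forall>c\<in>U. R c s}. g s))
    = (\<Sum>s\<in>{s \<in> X. \<forall>c\<in>C. \<not> R c s}. g s)"
  using assms
proof (induction C arbitrary: X rule: finite_induct)
  case (insert c C)
  let ?e = "\<lambda>X U. (\<Sum>s\<in>{s \<in> X. \<forall>c\<in>U. R c s}. g s)"
  let ?X' = "{s \<in> X. R c s}"
  have "?e X (insert c U) = ?e ?X' U" for U
    by (rule sum.cong) auto
  then have "(\<Sum>U\<in>Pow (insert c C). (-1) ^ card U * ?e X U)
      = (\<Sum>U\<in>Pow C. (-1) ^ card U * ?e X U) - (\<Sum>U\<in>Pow C. (-1) ^ card U * ?e ?X' U)"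
    by (simp only: alternating_sum_insert[OF insert.hyps] right_diff_distrib sum_subtractf)
  also have "\<dots> = sum g {s \<in> X. \<forall>c\<in>C. \<not> R c s} - sum g {s \<in> ?X'. \<forall>c\<in>C. \<not> R c s}"
    using insert.IH[of X] insert.IH[of ?X'] insert.prems by simp
  also have "\<dots> = sum g ({s \<in> X. \<forall>c\<in>C. \<not> R c s} - {s \<in> ?X'. \<forall>c\<in>C. \<not> R c s})"
    using insert.prems by (intro sum_diff[symmetric]) auto
  also have "{s \<in> X. \<forall>c\<in>C. \<not> R c s} - {s \<in> ?X'. \<forall>c\<in>C. \<not> R c s}
      = {s \<in> X. \<forall>c\<in>insert c C. \<not> R c s}" by auto
  finally show ?case .
qed simp

section \<open>Lower covers in distributive lattices\<close>

text \<open>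
  The lattices in question are a group and its finite sublattices, and the order is used in both
  directions. A lattice is therefore a carrier set with explicit operations, which makes passing to
  a sublattice or to the dual a matter of instantiation.
\<close>
locale distrib_lattice_on =
  fixes L :: "'a set" and le :: "'a \<Rightarrow> 'a \<Rightarrow> bool" (infix \<open>\<preceq>\<close> 50)
    and meet :: "'a \<Rightarrow> 'a \<Rightarrow> 'a" (infixl \<open>\<curlywedge>\<close> 70)
    and join :: "'a \<Rightarrow> 'a \<Rightarrow> 'a" (infixl \<open>\<curlyvee>\<close> 65)
  assumes leq_refl: "x \<in> L \<Longrightarrow> x \<preceq> x"
    and leq_antisym: "\<lbrakk>x \<preceq> y; y \<preceq> x; x \<in> L; y \<in> L\<rbrakk> \<Longrightarrow> x = y"
    and leq_trans: "\<lbrakk>x \<preceq> y; y \<preceq> z; x \<in> L; y \<in> L; z \<in> L\<rbrakk> \<Longrightarrow> x \<preceq> z"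
    and meet_closed: "\<lbrakk>x \<in> L; y \<in> L\<rbrakk> \<Longrightarrow> x \<curlywedge> y \<in> L"
    and meet_iff: "\<lbrakk>x \<in> L; y \<in> L; z \<in> L\<rbrakk> \<Longrightarrow> z \<preceq> x \<curlywedge> y \<longleftrightarrow> z \<preceq> x \<and> z \<preceq> y"
    and join_closed: "\<lbrakk>x \<in> L; y \<in> L\<rbrakk> \<Longrightarrow> x \<curlyvee> y \<in> L"
    and join_iff: "\<lbrakk>x \<in> L; y \<in> L; z \<in> L\<rbrakk> \<Longrightarrow> x \<curlyvee> y \<preceq> z \<longleftrightarrow> x \<preceq> z \<and> y \<preceq> z"
    and distrib: "\<lbrakk>x \<in> L; y \<in> L; z \<in> L\<rbrakk> \<Longrightarrow> x \<curlywedge> (y \<curlyvee> z) = (x \<curlywedge> y) \<curlyvee> (x \<curlywedge> z)"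
begin

lemma meet_le: "\<lbrakk>x \<in> L; y \<in> L\<rbrakk> \<Longrightarrow> x \<curlywedge> y \<preceq> x" "\<lbrakk>x \<in> L; y \<in> L\<rbrakk> \<Longrightarrow> x \<curlywedge> y \<preceq> y"
  using meet_iff[of x y "x \<curlywedge> y"] leq_refl meet_closed by blast+

lemma le_join: "\<lbrakk>x \<in> L; y \<in> L\<rbrakk> \<Longrightarrow> x \<preceq> x \<curlyvee> y" "\<lbrakk>x \<in> L; y \<in> L\<rbrakk> \<Longrightarrow> y \<preceq> x \<curlyvee> y"
  using join_iff[of x y "x \<curlyvee> y"] leq_refl join_closed by blast+

lemma meet_commute: "\<lbrakk>x \<in> L; y \<in> L\<rbrakk> \<Longrightarrow> x \<curlywedge> y = y \<curlywedge> x"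
  by (simp add: leq_antisym meet_closed meet_iff meet_le)

lemma join_commute: "\<lbrakk>x \<in> L; y \<in> L\<rbrakk> \<Longrightarrow> x \<curlyvee> y = y \<curlyvee> x"
  by (simp add: leq_antisym join_closed join_iff le_join)

lemma meet_absorb: "\<lbrakk>x \<in> L; y \<in> L; x \<preceq> y\<rbrakk> \<Longrightarrow> x \<curlywedge> y = x"
  by (simp add: leq_antisym meet_closed meet_iff meet_le leq_refl)

lemma join_absorb: "\<lbrakk>x \<in> L; y \<in> L; x \<preceq> y\<rbrakk> \<Longrightarrow> x \<curlyvee> y = y"
  by (simp add: leq_antisym join_closed join_iff le_join leq_refl)

lemma join_meet_distrib:
  assumes "x \<in> L" "y \<in> L" "z \<in> L"
  shows "x \<curlyvee> (y \<curlywedge> z) = (x \<curlyvee> y) \<curlywedge> (x \<curlyvee> z)"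
proof (rule leq_antisym)
  let ?r = "x \<curlyvee> (y \<curlywedge> z)"
  have L: "?r \<in> L" "y \<curlywedge> z \<in> L" "x \<curlyvee> y \<in> L" "x \<curlyvee> z \<in> L" "z \<curlywedge> x \<in> L" "z \<curlywedge> y \<in> L"
    using assms by (simp_all add: join_closed meet_closed)
  have "y \<curlywedge> z \<preceq> x \<curlyvee> y"
    by (rule leq_trans[OF meet_le(1) le_join(2)]) (use assms L in auto)
  moreover have "y \<curlywedge> z \<preceq> x \<curlyvee> z"
    by (rule leq_trans[OF meet_le(2) le_join(2)]) (use assms L in auto)
  ultimately show "?r \<preceq> (x \<curlyvee> y) \<curlywedge> (x \<curlyvee> z)"
    using assms L by (simp add: join_iff meet_iff meet_closed le_join)
  have "(x \<curlyvee> y) \<curlywedge> (x \<curlyvee> z) = ((x \<curlyvee> y) \<curlywedge> x) \<curlyvee> ((x \<curlyvee> y) \<curlywedge> z)"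
    using assms L by (simp add: distrib)
  also have "(x \<curlyvee> y) \<curlywedge> x = x"
    using assms L by (simp add: meet_commute[of _ x] meet_absorb le_join)
  also have "(x \<curlyvee> y) \<curlywedge> z = (z \<curlywedge> x) \<curlyvee> (z \<curlywedge> y)"
    using assms L by (simp add: meet_commute[of _ z] distrib)
  also have "x \<curlyvee> \<dots> \<preceq> ?r"
  proof -
    have "z \<curlywedge> x \<preceq> ?r"
      by (rule leq_trans[OF meet_le(2) le_join(1)]) (use assms L in auto)
    moreover have "z \<curlywedge> y \<preceq> ?r"
      using assms L by (simp add: meet_commute[of z] le_join)
    ultimately show ?thesis
      using assms L by (simp add: join_iff join_closed le_join)
  qed
  finally show "(x \<curlyvee> y) \<curlywedge> (x \<curlyvee> z) \<preceq> ?r" .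
qed (use assms in \<open>simp_all add: join_closed meet_closed\<close>)

lemma dual: "distrib_lattice_on L (\<lambda>x y. y \<preceq> x) (\<curlyvee>) (\<curlywedge>)"
  by unfold_locales
    (auto simp: leq_refl leq_antisym meet_closed join_closed meet_iff join_iff join_meet_distrib intro: leq_trans)

lemma sublattice:
  assumes "F \<subseteq> L"
    and "\<And>x y. \<lbrakk>x \<in> F; y \<in> F\<rbrakk> \<Longrightarrow> x \<curlywedge> y \<in> F"
    and "\<And>x y. \<lbrakk>x \<in> F; y \<in> F\<rbrakk> \<Longrightarrow> x \<curlyvee> y \<in> F"
  shows "distrib_lattice_on F (\<preceq>) (\<curlywedge>) (\<curlyvee>)"
  using assms(1)
  by unfold_locales
    (auto simp: subset_iff leq_refl leq_antisym meet_iff join_iff distrib assms(2,3) intro: leq_trans)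

text \<open>
  Adjoining one element \<open>a\<close> to a finite set \<open>Y\<close> closed under meets only requires adding \<open>a\<close> and the
  meets of \<open>a\<close> with the elements of \<open>Y\<close>.
\<close>
lemma finite_meet_closure:
  assumes "finite X" "X \<subseteq> L"
  obtains Y where "finite Y" "X \<subseteq> Y" "Y \<subseteq> L" "\<And>x y. \<lbrakk>x \<in> Y; y \<in> Y\<rbrakk> \<Longrightarrow> x \<curlywedge> y \<in> Y"
proof -
  have "\<exists>Y. finite Y \<and> X \<subseteq> Y \<and> Y \<subseteq> L \<and> (\<forall>x\<in>Y. \<forall>y\<in>Y. x \<curlywedge> y \<in> Y)"
    using assms
  proof (induction X rule: finite_induct)
    case (insert a X)
    then obtain Y where Y: "finite Y" "X \<subseteq> Y" "Y \<subseteq> L" "\<forall>x\<in>Y. \<forall>y\<in>Y. x \<curlywedge> y \<in> Y"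
      by auto
    have a: "a \<in> L" using insert.prems by simp
    let ?Y = "insert a (Y \<union> (\<curlywedge>) a ` Y)"
    have aa: "a \<curlywedge> a = a" using a by (simp add: meet_absorb leq_refl)
    have 1: "a \<curlywedge> (a \<curlywedge> y) = a \<curlywedge> y" "a \<curlywedge> y \<curlywedge> a = a \<curlywedge> y" "y \<curlywedge> a = a \<curlywedge> y" if "y \<in> Y" for y
    proof -
      have y: "y \<in> L" "a \<curlywedge> y \<in> L" using that Y a meet_closed by auto
      show "a \<curlywedge> y \<curlywedge> a = a \<curlywedge> y" using y a by (simp add: meet_absorb meet_le)
      then show "a \<curlywedge> (a \<curlywedge> y) = a \<curlywedge> y" using y a by (simp add: meet_commute)
      show "y \<curlywedge> a = a \<curlywedge> y" using y a by (simp add: meet_commute)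
    qed
    have 2: "x \<curlywedge> (a \<curlywedge> y) = a \<curlywedge> (x \<curlywedge> y)" "a \<curlywedge> x \<curlywedge> y = a \<curlywedge> (x \<curlywedge> y)"
      "a \<curlywedge> x \<curlywedge> (a \<curlywedge> y) = a \<curlywedge> (x \<curlywedge> y)"
      if "x \<in> Y" "y \<in> Y" for x y
    proof -
      have xy: "x \<in> L" "y \<in> L" using that Y by auto
      have eq: "u = v" if "u \<in> L" "v \<in> L" "\<And>z. z \<in> L \<Longrightarrow> z \<preceq> u \<longleftrightarrow> z \<preceq> v" for u v
        using that by (meson leq_antisym leq_refl)
      show "x \<curlywedge> (a \<curlywedge> y) = a \<curlywedge> (x \<curlywedge> y)" "a \<curlywedge> x \<curlywedge> y = a \<curlywedge> (x \<curlywedge> y)"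
        "a \<curlywedge> x \<curlywedge> (a \<curlywedge> y) = a \<curlywedge> (x \<curlywedge> y)"
        using xy a by (auto intro!: eq simp: meet_closed meet_iff)
    qed
    have "\<forall>x\<in>?Y. \<forall>y\<in>?Y. x \<curlywedge> y \<in> ?Y"
      using Y(4) by (auto simp: aa 1 2)
    moreover have "finite ?Y" "insert a X \<subseteq> ?Y" "?Y \<subseteq> L"
      using Y a meet_closed by auto
    ultimately show ?case by meson
  qed auto
  then show ?thesis using that by blast
qed

lemma finite_join_closure:
  assumes "finite X" "X \<subseteq> L"
  obtains Y where "finite Y" "X \<subseteq> Y" "Y \<subseteq> L" "\<And>x y. \<lbrakk>x \<in> Y; y \<in> Y\<rbrakk> \<Longrightarrow> x \<curlyvee> y \<in> Y"
  using distrib_lattice_on.finite_meet_closure[OF dual assms] by blast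

text \<open>
  The least closure under joins, unlike an arbitrary superset that is closed under joins, inherits
  closure under meets from \<open>X\<close>: its elements are joins of elements of \<open>X\<close>, and the
  distributive law moves meets past such joins.
\<close>
inductive_set join_hull :: "'a set \<Rightarrow> 'a set" for X where
  base: "x \<in> X \<Longrightarrow> x \<in> join_hull X"
| join: "\<lbrakk>x \<in> join_hull X; y \<in> join_hull X\<rbrakk> \<Longrightarrow> x \<curlyvee> y \<in> join_hull X"

text \<open>
  In a distributive lattice a finite set generates a finite sublattice: close the set under meets,
  then under joins.
\<close>
lemma finite_sublattice:
  assumes "finite X" "X \<subseteq> L"
  obtains F where "finite F" "X \<subseteq> F" "F \<subseteq> L" "distrib_lattice_on F (\<preceq>) (\<curlywedge>) (\<curlyvee>)"
proof -
  obtain Y where Y: "finite Y" "X \<subseteq> Y" "Y \<subseteq> L" "\<And>x y. \<lbrakk>x \<in> Y; y \<in> Y\<rbrakk> \<Longrightarrow> x \<curlywedge> y \<in> Y"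
    using finite_meet_closure assms by blast
  obtain Z where Z: "finite Z" "Y \<subseteq> Z" "Z \<subseteq> L" "\<And>x y. \<lbrakk>x \<in> Z; y \<in> Z\<rbrakk> \<Longrightarrow> x \<curlyvee> y \<in> Z"
    using finite_join_closure[OF Y(1,3)] by blast
  have "x \<in> Z" if "x \<in> join_hull Y" for x
    using that by induction (use Z in auto)
  then have sub: "join_hull Y \<subseteq> Z" by blast
  have L: "x \<in> L" if "x \<in> join_hull Y" for x
    using that sub Z by blast
  have 1: "y \<curlywedge> x \<in> join_hull Y" if "y \<in> Y" "x \<in> join_hull Y" for x y
    using that(2)
  proof induction
    case (base x)
    then show ?case using Y(4) that(1) by (simp add: join_hull.base)
  next
    case (join x x')
    have "y \<curlywedge> (x \<curlyvee> x') = (y \<curlywedge> x) \<curlyvee> (y \<curlywedge> x')"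
      using join.hyps L that(1) Y(3) by (intro distrib) auto
    then show ?case using join.IH by (simp add: join_hull.join)
  qed
  have 2: "x \<curlywedge> z \<in> join_hull Y" if "x \<in> join_hull Y" "z \<in> join_hull Y" for x z
    using that(1)
  proof induction
    case (join x x')
    have "(x \<curlyvee> x') \<curlywedge> z = (x \<curlywedge> z) \<curlyvee> (x' \<curlywedge> z)"
      using join.hyps L that(2) by (simp add: distrib meet_commute[of _ z] join_closed)
    then show ?case using join.IH by (simp add: join_hull.join)
  qed (rule 1[OF _ that(2)])
  show ?thesis
  proof
    show "distrib_lattice_on (join_hull Y) (\<preceq>) (\<curlywedge>) (\<curlyvee>)"
      using 2 L by (intro sublattice) (auto intro: join_hull.join)
    show "finite (join_hull Y)" using sub Z(1) finite_subset by blast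
  qed (use Y L in \<open>auto intro: join_hull.base\<close>)
qed

text \<open>
  The greatest lower bound of a finite nonempty subset of the carrier; for other sets it may be
  any value.
\<close>
definition glb :: "'a set \<Rightarrow> 'a" where
  "glb A = (SOME r. r \<in> L \<and> (\<forall>x\<in>L. x \<preceq> r \<longleftrightarrow> (\<forall>a\<in>A. x \<preceq> a)))"

lemma glb:
  assumes "finite A" "A \<noteq> {}" "A \<subseteq> L"
  shows "glb A \<in> L" and le_glb_iff: "x \<in> L \<Longrightarrow> x \<preceq> glb A \<longleftrightarrow> (\<forall>a\<in>A. x \<preceq> a)"
proof -
  have "\<exists>r. r \<in> L \<and> (\<forall>x\<in>L. x \<preceq> r \<longleftrightarrow> (\<forall>a\<in>A. x \<preceq> a))"
    using assms
  proof (induction A rule: finite_ne_induct)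
    case (insert a A)
    then obtain r where "r \<in> L" "\<forall>x\<in>L. x \<preceq> r \<longleftrightarrow> (\<forall>a\<in>A. x \<preceq> a)" by auto
    then show ?case
      using insert.prems by (intro exI[of _ "a \<curlywedge> r"]) (auto simp: meet_closed meet_iff)
  qed auto
  from someI_ex[OF this]
  show "glb A \<in> L" and "x \<in> L \<Longrightarrow> x \<preceq> glb A \<longleftrightarrow> (\<forall>a\<in>A. x \<preceq> a)"
    unfolding glb_def by blast+
qed

lemma glb_le: "\<lbrakk>finite A; A \<subseteq> L; a \<in> A\<rbrakk> \<Longrightarrow> glb A \<preceq> a"
  using glb(1)[of A] le_glb_iff[of A "glb A"] leq_refl by blast

lemma glb_singleton: "x \<in> L \<Longrightarrow> glb {x} = x"
  using glb(1)[of "{x}"] le_glb_iff[of "{x}" "glb {x}"] le_glb_iff[of "{x}" x]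
  by (simp add: leq_refl leq_antisym)

lemma glb_insert:
  assumes "finite A" "A \<noteq> {}" "A \<subseteq> L" "a \<in> L"
  shows "glb (insert a A) = a \<curlywedge> glb A"
proof -
  have *: "x \<preceq> glb (insert a A) \<longleftrightarrow> x \<preceq> a \<curlywedge> glb A" if "x \<in> L" for x
    using assms that by (simp add: le_glb_iff glb meet_iff)
  moreover have "glb (insert a A) \<in> L" "a \<curlywedge> glb A \<in> L"
    using assms by (simp_all add: glb meet_closed)
  ultimately show ?thesis by (meson leq_antisym leq_refl)
qed

definition lower_covers :: "'a \<Rightarrow> 'a set" where
  "lower_covers s = {c \<in> L. c \<preceq> s \<and> c \<noteq> s \<and> (\<forall>x\<in>L. c \<preceq> x \<longrightarrow> x \<preceq> s \<longrightarrow> x = c \<or> x = s)}"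

lemma lower_covers_subset: "lower_covers s \<subseteq> L"
  by (auto simp: lower_covers_def)

lemma join_lower_covers:
  assumes "s \<in> L" "c \<in> lower_covers s" "d \<in> lower_covers s" "c \<noteq> d"
  shows "c \<curlyvee> d = s"
proof -
  have L: "c \<in> L" "d \<in> L" "c \<preceq> s" "d \<preceq> s"
    using assms by (auto simp: lower_covers_def)
  then have "c \<curlyvee> d \<in> L" "c \<curlyvee> d \<preceq> s"
    using assms by (simp_all add: join_closed join_iff)
  then have "c \<curlyvee> d \<in> {c, s}" "c \<curlyvee> d \<in> {d, s}"
    using assms L le_join by (auto simp: lower_covers_def)
  then show ?thesis using assms(4) by auto
qed

text \<open>
  This needs distributivity (of joins over meets): \<open>c\<close> has join \<open>s\<close> with \<open>s\<close> itself and with every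
  element of \<open>U\<close>, hence also with their meet.
\<close>
lemma join_glb_lower_covers:
  assumes "finite U" "s \<in> L" "c \<in> lower_covers s" "U \<subseteq> lower_covers s" "c \<notin> U"
  shows "c \<curlyvee> glb (insert s U) = s"
  using assms(1,4,5)
proof (induction U rule: finite_induct)
  case empty
  then show ?case
    using assms by (auto simp: glb_singleton lower_covers_def join_absorb)
next
  case (insert d U)
  let ?r = "glb (insert s U)"
  have L: "c \<in> L" "d \<in> L" "insert s U \<subseteq> L"
    using assms(2,3) insert.prems lower_covers_subset by auto
  then have r: "?r \<in> L" using insert.hyps by (simp add: glb)
  have "c \<curlyvee> glb (insert s (insert d U)) = c \<curlyvee> (d \<curlywedge> ?r)"
    using L insert.hyps by (simp add: insert_commute[of s d] glb_insert)
  also have "\<dots> = (c \<curlyvee> d) \<curlywedge> (c \<curlyvee> ?r)"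
    using L r by (simp add: join_meet_distrib)
  also have "\<dots> = s"
    using insert assms by (simp add: join_lower_covers meet_absorb leq_refl)
  finally show ?case .
qed

lemma below_lower_cover:
  assumes "finite L" "s \<in> L" "x \<in> L" "x \<preceq> s" "x \<noteq> s"
  shows "\<exists>c\<in>lower_covers s. x \<preceq> c"
  using assms(3-5)
proof (induction "card {y \<in> L. x \<preceq> y}" arbitrary: x rule: less_induct)
  case less
  show ?case
  proof (cases "x \<in> lower_covers s")
    case True
    then show ?thesis using less.prems leq_refl by blast
  next
    case False
    then obtain y where y: "y \<in> L" "x \<preceq> y" "y \<preceq> s" "y \<noteq> x" "y \<noteq> s"
      using less.prems by (auto simp: lower_covers_def)
    have "{z \<in> L. y \<preceq> z} \<subset> {z \<in> L. x \<preceq> z}"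
      using y less.prems by (auto intro: leq_trans leq_refl leq_antisym)
    then have "card {z \<in> L. y \<preceq> z} < card {z \<in> L. x \<preceq> z}"
      using assms(1) by (intro psubset_card_mono) auto
    from less.hyps[OF this] obtain c where "c \<in> lower_covers s" "y \<preceq> c"
      using y by blast
    then show ?thesis
      using y less.prems lower_covers_subset leq_trans by blast
  qed
qed

text \<open>
  The inner sum is the Moebius inverse of \<open>f\<close>, in the form given by the lower covers alone.
  By induction, the sum of the inverse over all elements below \<open>m\<close> and below every
  element of a nonempty set \<open>U\<close> of lower covers is the value of \<open>f\<close> at their meet. Since every
  element strictly below \<open>m\<close> is below some lower cover, inclusion and exclusion then determines
  the sum over all elements below \<open>m\<close>.
\<close>
lemma Moebius_inversion_lower_covers:
  fixes f :: "'a \<Rightarrow> 'b::comm_ring_1"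
  assumes "finite L" "m \<in> L"
  shows "(\<Sum>s\<in>{s \<in> L. s \<preceq> m}. \<Sum>U\<in>Pow (lower_covers s). (-1) ^ card U * f (glb (insert s U))) = f m"
  using assms(2)
proof (induction "card {s \<in> L. s \<preceq> m}" arbitrary: m rule: less_induct)
  case less
  let ?g = "\<lambda>s. \<Sum>U\<in>Pow (lower_covers s). (-1) ^ card U * f (glb (insert s U))"
  let ?X = "{s \<in> L. s \<preceq> m}"
  let ?e = "\<lambda>U. \<Sum>s\<in>{s \<in> ?X. \<forall>c\<in>U. s \<preceq> c}. ?g s"
  have fin: "finite ?X" "finite (lower_covers m)"
    using assms(1) finite_subset[OF lower_covers_subset] by auto
  have e: "?e U = f (glb (insert m U))" if U: "U \<subseteq> lower_covers m" "U \<noteq> {}" for U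
  proof -
    have UL: "finite (insert m U)" "insert m U \<subseteq> L"
      using U less.prems lower_covers_subset finite_subset[OF _ fin(2)] by auto
    let ?r = "glb (insert m U)"
    have r: "?r \<in> L" using UL glb by simp
    have eq: "{s \<in> ?X. \<forall>c\<in>U. s \<preceq> c} = {s \<in> L. s \<preceq> ?r}"
      using UL by (auto simp: le_glb_iff)
    obtain c where c: "c \<in> U" "c \<in> L" "c \<preceq> m" "c \<noteq> m"
      using U by (auto simp: lower_covers_def)
    then have "\<not> m \<preceq> ?r"
      using UL less.prems le_glb_iff[of "insert m U" m] leq_antisym[of c m] by auto
    moreover have "?r \<preceq> m" using UL by (simp add: glb_le)
    ultimately have "{s \<in> L. s \<preceq> ?r} \<subset> ?X"
      using less.prems r by (auto intro: leq_trans leq_refl)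
    then have "card {s \<in> L. s \<preceq> ?r} < card ?X"
      using fin by (intro psubset_card_mono) auto
    from less.hyps[OF this r] show ?thesis unfolding eq .
  qed
  have "{s \<in> ?X. \<forall>c\<in>lower_covers m. \<not> s \<preceq> c} = {m}"
    using below_lower_cover[OF assms(1) less.prems] less.prems
    by (auto simp: leq_refl lower_covers_def dest: leq_antisym)
  then have "?g m = (\<Sum>U\<in>Pow (lower_covers m). (-1) ^ card U * ?e U)"
    using sum_inclusion_exclusion[OF fin(2,1), where R = "\<lambda>c s. s \<preceq> c" and g = ?g] by simp
  also have "\<dots> = ?e {} + (\<Sum>U\<in>Pow (lower_covers m) - {{}}. (-1) ^ card U * ?e U)"
    using fin by (subst sum.remove[of _ "{}"]) auto
  also have "(\<Sum>U\<in>Pow (lower_covers m) - {{}}. (-1) ^ card U * ?e U)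
      = (\<Sum>U\<in>Pow (lower_covers m) - {{}}. (-1) ^ card U * f (glb (insert m U)))"
    by (intro sum.cong refl) (use e in auto)
  finally have "?g m = ?e {} + \<dots>" .
  moreover have "?g m = f m + (\<Sum>U\<in>Pow (lower_covers m) - {{}}. (-1) ^ card U * f (glb (insert m U)))"
    using fin less.prems by (subst sum.remove[of _ "{}"]) (auto simp: glb_singleton)
  ultimately show ?case by simp
qed

end

section \<open>Positive kernels on a distributive lattice\<close>

context distrib_lattice_on begin

text \<open>
  The heart of the proof. Let \<open>u\<^sub>s\<close> be the sum of \<open>A s g\<^sub>i h\<^sub>i\<close> over the indices with \<open>s \<preceq> g\<^sub>i\<close>, so that
  \<open>A r s u\<^sub>s\<close> is the sum of \<open>A r g\<^sub>i h\<^sub>i\<close> over the same indices when \<open>r \<preceq> s\<close>. Moebius inversion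
  of \<open>r \<mapsto> \<langle>A r g\<^sub>j h\<^sub>j, A r g\<^sub>i h\<^sub>i\<rangle>\<close> at \<open>m = g\<^sub>i \<curlywedge> g\<^sub>j\<close> yields a sum over the \<open>s \<preceq> m\<close>, that is, over the
  \<open>s\<close> below both \<open>g\<^sub>i\<close> and \<open>g\<^sub>j\<close>. Interchanging the summations, the quadratic form becomes
  \[ \sum_s \sum_U (-1)^{|U|} \|A\, r_{s,U}\, s\, u_s\|^2, \]
  where \<open>U\<close> runs over the sets of lower covers of \<open>s\<close> and \<open>r\<^sub>s\<^sub>,\<^sub>U\<close> is the meet of \<open>s\<close> and \<open>U\<close>.
  For fixed \<open>s\<close> the sum over \<open>U\<close> is nonnegative: with \<open>r = r\<^sub>s\<^sub>,\<^sub>U\<close>, the elements \<open>c \<curlywedge> r\<close>, for the lower covers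
  \<open>c\<close> outside \<open>U\<close>, are strictly below \<open>r\<close> and have pairwise join \<open>r\<close> by distributivity, so that the
  column condition at \<open>r\<close> is the hypothesis of the lemma on alternating sums.
\<close>
lemma kernel_nonneg_finite:
  fixes A :: "'a \<Rightarrow> 'a \<Rightarrow> 'h \<Rightarrow> 'h::complex_hilbert_space"
  assumes "finite L"
    and add: "\<And>r s v w. A r s (v + w) = A r s v + A r s w"
    and comp: "\<And>r s t v. \<lbrakk>r \<in> L; s \<in> L; t \<in> L; r \<preceq> s; s \<preceq> t\<rbrakk> \<Longrightarrow> A r s (A s t v) = A r t v"
    and column: "\<And>s v (k::nat) x. \<lbrakk>s \<in> L; \<And>i. i < k \<Longrightarrow> x i \<in> L \<and> x i \<preceq> s \<and> x i \<noteq> s;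
        \<And>i j. \<lbrakk>i < k; j < k; i \<noteq> j\<rbrakk> \<Longrightarrow> x i \<curlyvee> x j = s\<rbrakk>
        \<Longrightarrow> (\<Sum>i<k. (norm (A (x i) s v))\<^sup>2) \<le> (norm v)\<^sup>2"
    and g: "\<And>i. i < n \<Longrightarrow> g i \<in> L"
  shows "(\<Sum>i<(n::nat). \<Sum>j<n. cinner (A (g i \<curlywedge> g j) (g j) (h j)) (A (g i \<curlywedge> g j) (g i) (h i)))
    \<in> \<real>\<^sub>\<ge>\<^sub>0"
proof -
  define f where "f i j r = cinner (A r (g j) (h j)) (A r (g i) (h i))" for i j r
  define I where "I s = {i. i < n \<and> s \<preceq> g i}" for s
  define u where "u s = (\<Sum>i\<in>I s. A s (g i) (h i))" for s
  define a where "a s U = (norm (A (glb (insert s U)) s (u s)))\<^sup>2" for s U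
  have finI: "finite (I s)" for s by (simp add: I_def)
  have fincov: "finite (lower_covers s)" for s
    by (rule finite_subset[OF lower_covers_subset assms(1)])
  have glbU: "glb (insert s U) \<in> L" "glb (insert s U) \<preceq> s" "finite U" "insert s U \<subseteq> L"
    if "s \<in> L" "U \<subseteq> lower_covers s" for s U
  proof -
    show *: "finite U" "insert s U \<subseteq> L"
      using that finite_subset[OF _ fincov] lower_covers_subset[of s] by auto
    show "glb (insert s U) \<in> L" "glb (insert s U) \<preceq> s"
      using * by (simp_all add: glb glb_le)
  qed
  have A_sum: "A r s (\<Sum>i\<in>J. v i) = (\<Sum>i\<in>J. A r s (v i))" for r s J and v :: "nat \<Rightarrow> 'h"
  proof -
    have "A r s 0 = 0" using add[of r s 0 0] by simp
    then show ?thesis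
      by (induction J rule: infinite_finite_induct) (simp_all add: add)
  qed
  have pairs: "(\<Sum>i\<in>I s. \<Sum>j\<in>I s. f i j (glb (insert s U))) = of_real (a s U)"
    if s: "s \<in> L" "U \<subseteq> lower_covers s" for s U
  proof -
    let ?r = "glb (insert s U)"
    have "A ?r s (u s) = (\<Sum>i\<in>I s. A ?r (g i) (h i))"
      unfolding u_def A_sum using glbU[OF s] s(1) g
      by (intro sum.cong refl comp) (auto simp: I_def)
    then have "of_real (a s U)
        = cinner (\<Sum>j\<in>I s. A ?r (g j) (h j)) (\<Sum>i\<in>I s. A ?r (g i) (h i))"
      by (simp only: a_def cinner_norm_sq)
    also have "\<dots> = (\<Sum>j\<in>I s. \<Sum>i\<in>I s. f i j ?r)"
      unfolding f_def by (subst cinner_sum_left) (simp only: cinner_sum_right)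
    also have "\<dots> = (\<Sum>i\<in>I s. \<Sum>j\<in>I s. f i j ?r)"
      by (rule sum.swap)
    finally show ?thesis by (rule sym)
  qed
  have nonneg: "0 \<le> (\<Sum>U\<in>Pow (lower_covers s). (-1) ^ card U * a s U)" if s: "s \<in> L" for s
  proof (rule alternating_sum_nonneg[OF fincov])
    fix U assume U: "U \<subseteq> lower_covers s"
    show "0 \<le> a s U" by (simp add: a_def)
    let ?r = "glb (insert s U)"
    note r = glbU[OF s U]
    define m where "m = card (lower_covers s - U)"
    obtain e where e: "bij_betw e {..<m} (lower_covers s - U)"
      using ex_bij_betw_nat_finite[of "lower_covers s - U"] fincov
      by (auto simp: m_def atLeast0LessThan)
    have e_in: "e i \<in> L" "e i \<in> lower_covers s" "e i \<notin> U" if "i < m" for i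
      using bij_betwE[OF e] that lower_covers_subset by auto
    have x: "e i \<curlywedge> ?r = glb (insert s (insert (e i) U))" if "i < m" for i
      using glb_insert[of "insert s U" "e i"] r e_in[OF that] by (simp add: insert_commute)
    have "(\<Sum>c\<in>lower_covers s - U. a s (insert c U)) = (\<Sum>i<m. a s (insert (e i) U))"
      by (rule sum.reindex_bij_betw[OF e, symmetric])
    also have "\<dots> = (\<Sum>i<m. (norm (A (e i \<curlywedge> ?r) ?r (A ?r s (u s))))\<^sup>2)"
      using r s e_in
      by (intro sum.cong refl) (simp add: a_def flip: x add: comp meet_closed meet_le)
    also have "\<dots> \<le> (norm (A ?r s (u s)))\<^sup>2"
    proof (rule column)
      fix i assume i: "i < m"
      have "e i \<curlyvee> ?r = s"
        using join_glb_lower_covers r s U e_in[OF i] by blast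
      moreover have "e i \<noteq> s" using e_in[OF i] by (auto simp: lower_covers_def)
      ultimately have "e i \<curlywedge> ?r \<noteq> ?r"
        using e_in[OF i] r meet_le(1)[of "e i" ?r] join_absorb[of ?r "e i"] join_commute[of "e i" ?r]
        by auto
      then show "e i \<curlywedge> ?r \<in> L \<and> e i \<curlywedge> ?r \<preceq> ?r \<and> e i \<curlywedge> ?r \<noteq> ?r"
        using e_in[OF i] r by (simp add: meet_closed meet_le)
    next
      fix i j assume ij: "i < m" "j < m" "i \<noteq> j"
      then have "e i \<noteq> e j"
        using bij_betw_imp_inj_on[OF e] by (auto dest: inj_onD)
      then have "e i \<curlyvee> e j = s"
        using join_lower_covers s ij e_in by blast
      then have "?r \<curlywedge> (e i \<curlyvee> e j) = ?r"
        using r s by (simp add: meet_absorb)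
      then show "(e i \<curlywedge> ?r) \<curlyvee> (e j \<curlywedge> ?r) = ?r"
        using ij e_in r by (simp add: distrib meet_commute[of ?r])
    qed (rule r)
    finally show "(\<Sum>c\<in>lower_covers s - U. a s (insert c U)) \<le> a s U"
      by (simp add: a_def)
  qed
  have "(\<Sum>i<n. \<Sum>j<n. f i j (g i \<curlywedge> g j))
      = (\<Sum>i<n. \<Sum>j<n. \<Sum>s\<in>L. if i \<in> I s \<and> j \<in> I s
          then \<Sum>U\<in>Pow (lower_covers s). (-1) ^ card U * f i j (glb (insert s U)) else 0)"
  proof (intro sum.cong refl)
    fix i j assume "i \<in> {..<n}" "j \<in> {..<n}"
    then have ij: "i < n" "j < n" "g i \<in> L" "g j \<in> L" using g by auto
    have "{s \<in> L. s \<preceq> g i \<curlywedge> g j} = {s \<in> L. i \<in> I s \<and> j \<in> I s}"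
      using ij by (auto simp: I_def meet_iff)
    then show "f i j (g i \<curlywedge> g j) = (\<Sum>s\<in>L. if i \<in> I s \<and> j \<in> I s
          then \<Sum>U\<in>Pow (lower_covers s). (-1) ^ card U * f i j (glb (insert s U)) else 0)"
      using Moebius_inversion_lower_covers[OF assms(1) meet_closed[OF ij(3,4)], of "f i j"]
      by (simp only: sum.inter_filter[OF assms(1)])
  qed
  also have "\<dots> = (\<Sum>i<n. \<Sum>s\<in>L. \<Sum>j<n. if i \<in> I s \<and> j \<in> I s
          then \<Sum>U\<in>Pow (lower_covers s). (-1) ^ card U * f i j (glb (insert s U)) else 0)"
    by (intro sum.cong refl sum.swap)
  also have "\<dots> = (\<Sum>s\<in>L. \<Sum>i<n. \<Sum>j<n. if i \<in> I s \<and> j \<in> I s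
          then \<Sum>U\<in>Pow (lower_covers s). (-1) ^ card U * f i j (glb (insert s U)) else 0)"
    by (rule sum.swap)
  also have "\<dots> = (\<Sum>s\<in>L. of_real (\<Sum>U\<in>Pow (lower_covers s). (-1) ^ card U * a s U))"
  proof (intro sum.cong refl)
    fix s assume s: "s \<in> L"
    let ?d = "\<lambda>i j. \<Sum>U\<in>Pow (lower_covers s). (-1) ^ card U * f i j (glb (insert s U))"
    have In: "{..<n} \<inter> I s = I s" by (auto simp: I_def)
    have "(\<Sum>i<n. \<Sum>j<n. if i \<in> I s \<and> j \<in> I s then ?d i j else 0)
        = (\<Sum>i<n. if i \<in> I s then \<Sum>j<n. if j \<in> I s then ?d i j else 0 else 0)"
      by (intro sum.cong refl) auto
    also have "\<dots> = (\<Sum>i\<in>I s. \<Sum>j\<in>I s. ?d i j)"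
      by (simp add: sum.inter_restrict[symmetric] In)
    also have "\<dots> = (\<Sum>i\<in>I s. \<Sum>U\<in>Pow (lower_covers s). \<Sum>j\<in>I s.
        (-1) ^ card U * f i j (glb (insert s U)))"
      by (intro sum.cong refl sum.swap)
    also have "\<dots> = (\<Sum>U\<in>Pow (lower_covers s). (-1) ^ card U *
        (\<Sum>i\<in>I s. \<Sum>j\<in>I s. f i j (glb (insert s U))))"
      by (subst sum.swap) (simp only: sum_distrib_left)
    also have "\<dots> = of_real (\<Sum>U\<in>Pow (lower_covers s). (-1) ^ card U * a s U)"
      using s pairs by simp
    finally show "(\<Sum>i<n. \<Sum>j<n. if i \<in> I s \<and> j \<in> I s then ?d i j else 0)
      = of_real (\<Sum>U\<in>Pow (lower_covers s). (-1) ^ card U * a s U)" .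
  qed
  also have "\<dots> \<in> \<real>\<^sub>\<ge>\<^sub>0"
    using nonneg by (simp only: of_real_sum[symmetric] nonneg_Reals_of_real_iff sum_nonneg)
  finally show ?thesis by (simp only: f_def)
qed

text \<open>
  A lattice ordered group is infinite unless it is trivial, but only the finite sublattice generated
  by the \<open>g\<^sub>i\<close> enters.
\<close>
theorem kernel_nonneg:
  fixes A :: "'a \<Rightarrow> 'a \<Rightarrow> 'h \<Rightarrow> 'h::complex_hilbert_space"
  assumes "\<And>r s v w. A r s (v + w) = A r s v + A r s w"
    and "\<And>r s t v. \<lbrakk>r \<in> L; s \<in> L; t \<in> L; r \<preceq> s; s \<preceq> t\<rbrakk> \<Longrightarrow> A r s (A s t v) = A r t v"
    and "\<And>s v (k::nat) x. \<lbrakk>s \<in> L; \<And>i. i < k \<Longrightarrow> x i \<in> L \<and> x i \<preceq> s \<and> x i \<noteq> s;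
        \<And>i j. \<lbrakk>i < k; j < k; i \<noteq> j\<rbrakk> \<Longrightarrow> x i \<curlyvee> x j = s\<rbrakk>
        \<Longrightarrow> (\<Sum>i<k. (norm (A (x i) s v))\<^sup>2) \<le> (norm v)\<^sup>2"
    and "\<And>i. i < n \<Longrightarrow> g i \<in> L"
  shows "(\<Sum>i<(n::nat). \<Sum>j<n. cinner (A (g i \<curlywedge> g j) (g j) (h j)) (A (g i \<curlywedge> g j) (g i) (h i)))
    \<in> \<real>\<^sub>\<ge>\<^sub>0"
proof -
  obtain F where F: "finite F" "g ` {..<n} \<subseteq> F" "F \<subseteq> L" "distrib_lattice_on F (\<preceq>) (\<curlywedge>) (\<curlyvee>)"
    using finite_sublattice[of "g ` {..<n}"] assms(4) by auto
  show ?thesis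
  proof (rule distrib_lattice_on.kernel_nonneg_finite[OF F(4,1) assms(1)])
    show "A r s (A s t v) = A r t v"
      if "r \<in> F" "s \<in> F" "t \<in> F" "r \<preceq> s" "s \<preceq> t" for r s t v
      using that F(3) by (intro assms(2)) auto
    show "(\<Sum>i<k. (norm (A (x i) s v))\<^sup>2) \<le> (norm v)\<^sup>2"
      if "s \<in> F" "\<And>i. i < k \<Longrightarrow> x i \<in> F \<and> x i \<preceq> s \<and> x i \<noteq> s"
        "\<And>i j. \<lbrakk>i < k; j < k; i \<noteq> j\<rbrakk> \<Longrightarrow> x i \<curlyvee> x j = s" for s v and k :: nat and x
      using that F(3) by (intro assms(3)) auto
    show "g i \<in> F" if "i < n" for i
      using that F(2) by auto
  qed
qed

end

section \<open>The order of a lattice ordered group\<close>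

context lattice_ordered_group begin

definition cone_le :: "'a \<Rightarrow> 'a \<Rightarrow> bool" (infix \<open>\<unlhd>\<close> 50) where
  "x \<unlhd> y \<longleftrightarrow> inv x \<otimes> y \<in> P"

abbreviation cone_join (infixl \<open>\<curlyvee>\<close> 65) where "x \<curlyvee> y \<equiv> x \<squnion>\<^bsub>cone_order G P\<^esub> y"
abbreviation cone_meet (infixl \<open>\<curlywedge>\<close> 70) where "x \<curlywedge> y \<equiv> x \<sqinter>\<^bsub>cone_order G P\<^esub> y"

lemma cone_order_simps:
  "carrier (cone_order G P) = carrier G" "x \<sqsubseteq>\<^bsub>cone_order G P\<^esub> y \<longleftrightarrow> x \<unlhd> y"
  by (simp_all add: cone_order_def cone_le_def)

lemma cone_le_mult_left_iff:
  "\<lbrakk>x \<in> carrier G; y \<in> carrier G; z \<in> carrier G\<rbrakk> \<Longrightarrow> z \<otimes> x \<unlhd> z \<otimes> y \<longleftrightarrow> x \<unlhd> y"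
  unfolding cone_le_def by (simp add: inv_mult_group m_assoc) (simp flip: m_assoc)

text \<open>
  Left translations preserve the order by its definition; for right translations one needs that
  the cone is invariant under conjugation.
\<close>
lemma cone_le_mult_right:
  assumes "x \<in> carrier G" "y \<in> carrier G" "z \<in> carrier G" "x \<unlhd> y"
  shows "x \<otimes> z \<unlhd> y \<otimes> z"
  using cone_conj[of "inv z" "inv x \<otimes> y"] assms
  unfolding cone_le_def by (simp add: inv_mult_group m_assoc)

lemma cone_le_mult_right_iff:
  assumes "x \<in> carrier G" "y \<in> carrier G" "z \<in> carrier G"
  shows "x \<otimes> z \<unlhd> y \<otimes> z \<longleftrightarrow> x \<unlhd> y"
  using cone_le_mult_right[of x y z] cone_le_mult_right[of "x \<otimes> z" "y \<otimes> z" "inv z"] assms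
  by (auto simp: m_assoc)

lemma cone_le_refl: "x \<in> carrier G \<Longrightarrow> x \<unlhd> x"
  by (simp add: cone_le_def cone_one)

lemma cone_lattice_facts:
  shows "\<lbrakk>x \<unlhd> y; y \<unlhd> x; x \<in> carrier G; y \<in> carrier G\<rbrakk> \<Longrightarrow> x = y"
    and "\<lbrakk>x \<unlhd> y; y \<unlhd> z; x \<in> carrier G; y \<in> carrier G; z \<in> carrier G\<rbrakk> \<Longrightarrow> x \<unlhd> z"
    and "\<lbrakk>x \<in> carrier G; y \<in> carrier G\<rbrakk> \<Longrightarrow> x \<curlywedge> y \<in> carrier G"
    and "\<lbrakk>x \<in> carrier G; y \<in> carrier G\<rbrakk> \<Longrightarrow> x \<curlyvee> y \<in> carrier G"
    and "\<lbrakk>x \<in> carrier G; y \<in> carrier G; z \<in> carrier G\<rbrakk> \<Longrightarrow> z \<unlhd> x \<curlywedge> y \<longleftrightarrow> z \<unlhd> x \<and> z \<unlhd> y"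
    and "\<lbrakk>x \<in> carrier G; y \<in> carrier G; z \<in> carrier G\<rbrakk> \<Longrightarrow> x \<curlyvee> y \<unlhd> z \<longleftrightarrow> x \<unlhd> z \<and> y \<unlhd> z"
proof -
  interpret ord: Lattice.lattice "cone_order G P" by (rule cone_lattice)
  show "\<lbrakk>x \<unlhd> y; y \<unlhd> x; x \<in> carrier G; y \<in> carrier G\<rbrakk> \<Longrightarrow> x = y"
    using ord.le_antisym[of x y] by (simp add: cone_order_simps)
  show tr: "x \<unlhd> z"
    if "x \<unlhd> y" "y \<unlhd> z" "x \<in> carrier G" "y \<in> carrier G" "z \<in> carrier G" for x y z
    using ord.le_trans[of x y z] that by (simp add: cone_order_simps)
  show m: "\<lbrakk>x \<in> carrier G; y \<in> carrier G\<rbrakk> \<Longrightarrow> x \<curlywedge> y \<in> carrier G"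
    using ord.meet_closed[of x y] by (simp add: cone_order_simps)
  show j: "\<lbrakk>x \<in> carrier G; y \<in> carrier G\<rbrakk> \<Longrightarrow> x \<curlyvee> y \<in> carrier G"
    using ord.join_closed[of x y] by (simp add: cone_order_simps)
  show "z \<unlhd> x \<curlywedge> y \<longleftrightarrow> z \<unlhd> x \<and> z \<unlhd> y" if "x \<in> carrier G" "y \<in> carrier G" "z \<in> carrier G"
    using ord.meet_le[of z x y] ord.meet_left[of x y] ord.meet_right[of x y]
      tr[of z "x \<curlywedge> y" x] tr[of z "x \<curlywedge> y" y] that m by (auto simp: cone_order_simps)
  show "x \<curlyvee> y \<unlhd> z \<longleftrightarrow> x \<unlhd> z \<and> y \<unlhd> z" if "x \<in> carrier G" "y \<in> carrier G" "z \<in> carrier G"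
    using ord.join_le[of x z y] ord.join_left[of x y] ord.join_right[of x y]
      tr[of x "x \<curlyvee> y" z] tr[of y "x \<curlyvee> y" z] that j by (auto simp: cone_order_simps)
qed

lemmas cone_le_antisym = cone_lattice_facts(1)
  and cone_le_trans = cone_lattice_facts(2)
  and cone_meet_closed = cone_lattice_facts(3)
  and cone_join_closed = cone_lattice_facts(4)
  and le_cone_meet_iff = cone_lattice_facts(5)
  and cone_join_le_iff = cone_lattice_facts(6)

text \<open>
  Lattice ordered groups are distributive. With \<open>w = y \<curlyvee> z\<close>, \<open>m = x \<curlywedge> w\<close> and \<open>d\<close> the right hand side,
  both \<open>v = y\<close> and \<open>v = z\<close> satisfy \<open>v w\<^sup>-\<^sup>1 m \<unlhd> x \<curlywedge> v \<unlhd> d\<close>, because \<open>v w\<^sup>-\<^sup>1 \<unlhd> \<one>\<close> and \<open>w\<^sup>-\<^sup>1 m \<unlhd> \<one>\<close>.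
  Hence \<open>v \<unlhd> d m\<^sup>-\<^sup>1 w\<close> for both, so \<open>w \<unlhd> d m\<^sup>-\<^sup>1 w\<close>, and cancelling \<open>w\<close> gives \<open>m \<unlhd> d\<close>.
\<close>
lemma cone_distrib_le:
  assumes "x \<in> carrier G" "y \<in> carrier G" "z \<in> carrier G"
  shows "x \<curlywedge> (y \<curlyvee> z) \<unlhd> (x \<curlywedge> y) \<curlyvee> (x \<curlywedge> z)"
proof -
  let ?w = "y \<curlyvee> z" and ?m = "x \<curlywedge> (y \<curlyvee> z)" and ?d = "(x \<curlywedge> y) \<curlyvee> (x \<curlywedge> z)"
  have car: "?w \<in> carrier G" "?m \<in> carrier G" "?d \<in> carrier G" "x \<curlywedge> y \<in> carrier G" "x \<curlywedge> z \<in> carrier G"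
    using assms by (simp_all add: cone_meet_closed cone_join_closed)
  have m: "?m \<unlhd> x" "?m \<unlhd> ?w"
    using le_cone_meet_iff[of x ?w ?m] car assms by (simp_all add: cone_le_refl)
  have *: "v \<unlhd> ?d \<otimes> inv ?m \<otimes> ?w"
    if v: "v \<in> carrier G" "v \<unlhd> ?w" "x \<curlywedge> v \<unlhd> ?d" for v
  proof -
    have "v \<otimes> inv ?w \<otimes> ?m \<unlhd> ?m"
      using cone_le_mult_right[of v ?w "inv ?w \<otimes> ?m"] v car by (simp add: m_assoc[symmetric])
    then have "v \<otimes> inv ?w \<otimes> ?m \<unlhd> x"
      using m(1) v car assms by (meson cone_le_trans inv_closed m_closed)
    moreover have "v \<otimes> inv ?w \<otimes> ?m \<unlhd> v"
      using cone_le_mult_left_iff[of ?m ?w "v \<otimes> inv ?w"] m(2) v car by (simp add: m_assoc)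
    ultimately have "v \<otimes> inv ?w \<otimes> ?m \<unlhd> x \<curlywedge> v"
      using v car assms by (simp add: le_cone_meet_iff)
    then have "v \<otimes> inv ?w \<otimes> ?m \<unlhd> ?d"
      using v car assms by (meson cone_le_trans cone_meet_closed inv_closed m_closed)
    then show ?thesis
      using cone_le_mult_right[of "v \<otimes> inv ?w \<otimes> ?m" ?d "inv ?m \<otimes> ?w"] v car
      by (simp add: m_assoc inv_solve_left') (simp add: m_assoc[symmetric])
  qed
  have "?w \<unlhd> ?d \<otimes> inv ?m \<otimes> ?w"
    using *[of y] *[of z] cone_join_le_iff[of y z ?w] cone_join_le_iff[of "x \<curlywedge> y" "x \<curlywedge> z" ?d] assms car
    by (simp add: cone_join_le_iff cone_le_refl)
  then show ?thesis
    using cone_le_mult_right[of ?w "?d \<otimes> inv ?m \<otimes> ?w" "inv ?w \<otimes> ?m"] car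
    by (simp add: m_assoc) (simp add: m_assoc[symmetric])
qed

lemma cone_order_distrib_lattice: "distrib_lattice_on (carrier G) (\<unlhd>) (\<curlywedge>) (\<curlyvee>)"
proof unfold_locales
  fix x y z assume xyz: "x \<in> carrier G" "y \<in> carrier G" "z \<in> carrier G"
  have car: "y \<curlyvee> z \<in> carrier G" "x \<curlywedge> y \<in> carrier G" "x \<curlywedge> z \<in> carrier G"
    "x \<curlywedge> (y \<curlyvee> z) \<in> carrier G" "(x \<curlywedge> y) \<curlyvee> (x \<curlywedge> z) \<in> carrier G"
    using xyz by (simp_all add: cone_meet_closed cone_join_closed)
  have le: "x \<curlywedge> y \<unlhd> x" "x \<curlywedge> y \<unlhd> y" "x \<curlywedge> z \<unlhd> x" "x \<curlywedge> z \<unlhd> z" "y \<unlhd> y \<curlyvee> z" "z \<unlhd> y \<curlyvee> z"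
    using xyz car le_cone_meet_iff[of x y "x \<curlywedge> y"] le_cone_meet_iff[of x z "x \<curlywedge> z"]
      cone_join_le_iff[of y z "y \<curlyvee> z"] by (simp_all add: cone_le_refl)
  have "x \<curlywedge> y \<unlhd> y \<curlyvee> z" "x \<curlywedge> z \<unlhd> y \<curlyvee> z"
    using cone_le_trans[OF le(2,5)] cone_le_trans[OF le(4,6)] xyz car by simp_all
  then have "(x \<curlywedge> y) \<curlyvee> (x \<curlywedge> z) \<unlhd> x \<curlywedge> (y \<curlyvee> z)"
    using xyz car le by (simp add: cone_join_le_iff le_cone_meet_iff)
  then show "x \<curlywedge> (y \<curlyvee> z) = (x \<curlywedge> y) \<curlyvee> (x \<curlywedge> z)"
    using cone_le_antisym[OF cone_distrib_le] xyz car by simp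
next
  fix x y z
  assume "x \<unlhd> y" "y \<unlhd> z" "x \<in> carrier G" "y \<in> carrier G" "z \<in> carrier G"
  then show "x \<unlhd> z" by (rule cone_le_trans)
next
  fix x y
  assume "x \<unlhd> y" "y \<unlhd> x" "x \<in> carrier G" "y \<in> carrier G"
  then show "x = y" by (rule cone_le_antisym)
qed (simp_all add: cone_le_refl cone_meet_closed cone_join_closed
    le_cone_meet_iff cone_join_le_iff)

lemma cone_eqI_lower:
  assumes "\<And>z. z \<in> carrier G \<Longrightarrow> z \<unlhd> x \<longleftrightarrow> z \<unlhd> y" "x \<in> carrier G" "y \<in> carrier G"
  shows "x = y"
  using assms by (meson cone_le_antisym cone_le_refl)

lemma cone_eqI_upper:
  assumes "\<And>z. z \<in> carrier G \<Longrightarrow> x \<unlhd> z \<longleftrightarrow> y \<unlhd> z" "x \<in> carrier G" "y \<in> carrier G"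
  shows "x = y"
  using assms by (meson cone_le_antisym cone_le_refl)

lemma left_quotient_le_iff:
  assumes "x \<in> carrier G" "y \<in> carrier G" "z \<in> carrier G"
  shows "inv x \<otimes> y \<unlhd> z \<longleftrightarrow> y \<otimes> inv z \<unlhd> x" and "z \<unlhd> inv x \<otimes> y \<longleftrightarrow> x \<unlhd> y \<otimes> inv z"
    and "inv x \<otimes> y \<unlhd> z \<longleftrightarrow> y \<unlhd> x \<otimes> z" and "z \<unlhd> inv x \<otimes> y \<longleftrightarrow> x \<otimes> z \<unlhd> y"
proof -
  have xz: "x \<otimes> (inv x \<otimes> y) = y"
    using assms by (simp flip: m_assoc)
  show 1: "inv x \<otimes> y \<unlhd> z \<longleftrightarrow> y \<unlhd> x \<otimes> z" and 2: "z \<unlhd> inv x \<otimes> y \<longleftrightarrow> x \<otimes> z \<unlhd> y"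
    using cone_le_mult_left_iff[of "inv x \<otimes> y" z x] cone_le_mult_left_iff[of z "inv x \<otimes> y" x] assms
    by (simp_all add: xz)
  show "inv x \<otimes> y \<unlhd> z \<longleftrightarrow> y \<otimes> inv z \<unlhd> x" and "z \<unlhd> inv x \<otimes> y \<longleftrightarrow> x \<unlhd> y \<otimes> inv z"
    using cone_le_mult_right_iff[of y "x \<otimes> z" "inv z"] cone_le_mult_right_iff[of "x \<otimes> z" y "inv z"] assms
    by (simp_all add: 1 2 m_assoc)
qed

text \<open>
  The first form suits right regularity, where the kernel is governed by meets, and the second suits
  left regularity, where it is governed by joins.
\<close>
lemma pos_part_left_quotient:
  assumes "p \<in> carrier G" "q \<in> carrier G"
  shows "pos_part G P (inv p \<otimes> q) = inv (p \<curlywedge> q) \<otimes> q"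
    and "pos_part G P (inv p \<otimes> q) = inv p \<otimes> (p \<curlyvee> q)"
proof -
  have one: "\<one> \<unlhd> z \<longleftrightarrow> q \<otimes> inv z \<unlhd> q" "\<one> \<unlhd> z \<longleftrightarrow> p \<unlhd> p \<otimes> z" if "z \<in> carrier G" for z
    using left_quotient_le_iff(1)[of q q z] left_quotient_le_iff(3)[of p p z] that assms by simp_all
  show "pos_part G P (inv p \<otimes> q) = inv (p \<curlywedge> q) \<otimes> q"
    unfolding pos_part_def
    by (rule cone_eqI_upper)
      (use assms in \<open>simp_all add: cone_join_le_iff cone_join_closed cone_meet_closed
          left_quotient_le_iff(1) le_cone_meet_iff one(1)\<close>)
  show "pos_part G P (inv p \<otimes> q) = inv p \<otimes> (p \<curlyvee> q)"
    unfolding pos_part_def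
    by (rule cone_eqI_upper)
      (use assms in \<open>auto simp: cone_join_le_iff cone_join_closed cone_meet_closed
          left_quotient_le_iff(3) one(2)\<close>)
qed

lemma cone_join_commute: "\<lbrakk>x \<in> carrier G; y \<in> carrier G\<rbrakk> \<Longrightarrow> x \<curlyvee> y = y \<curlyvee> x"
  by (rule distrib_lattice_on.join_commute[OF cone_order_distrib_lattice])

lemma cone_meet_commute: "\<lbrakk>x \<in> carrier G; y \<in> carrier G\<rbrakk> \<Longrightarrow> x \<curlywedge> y = y \<curlywedge> x"
  by (rule distrib_lattice_on.meet_commute[OF cone_order_distrib_lattice])

lemma neg_part_left_quotient:
  assumes "p \<in> carrier G" "q \<in> carrier G"
  shows "neg_part G P (inv p \<otimes> q) = inv (p \<curlywedge> q) \<otimes> p"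
    and "neg_part G P (inv p \<otimes> q) = inv q \<otimes> (p \<curlyvee> q)"
proof -
  have "neg_part G P (inv p \<otimes> q) = pos_part G P (inv q \<otimes> p)"
    using assms by (simp add: neg_part_def pos_part_def inv_mult_group)
  then show "neg_part G P (inv p \<otimes> q) = inv (p \<curlywedge> q) \<otimes> p"
    and "neg_part G P (inv p \<otimes> q) = inv q \<otimes> (p \<curlyvee> q)"
    using pos_part_left_quotient[of q p] assms by (simp_all add: cone_meet_commute cone_join_commute)
qed

lemma pos_part_in_cone: "g \<in> carrier G \<Longrightarrow> pos_part G P g \<in> P"
  using cone_join_le_iff[of g \<one> "g \<curlyvee> \<one>"] cone_join_closed[of g \<one>]
  by (simp add: pos_part_def cone_le_refl) (simp add: cone_le_def)

lemma neg_part_in_cone: "g \<in> carrier G \<Longrightarrow> neg_part G P g \<in> P"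
  using pos_part_in_cone[of "inv g"] by (simp add: pos_part_def neg_part_def)

lemma pos_part_one: "pos_part G P \<one> = \<one>" and neg_part_one: "neg_part G P \<one> = \<one>"
proof -
  show "pos_part G P \<one> = \<one>"
    unfolding pos_part_def
    by (rule cone_eqI_upper) (simp_all add: cone_join_le_iff cone_join_closed)
  then show "neg_part G P \<one> = \<one>" by (simp add: pos_part_def neg_part_def)
qed

text \<open>
  Translation by \<open>s\<close> after inversion is an order-reversing bijection that sends \<open>s\<close> to the identity,
  so it turns joins equal to \<open>s\<close> into meets equal to the identity. This is how the column condition on
  the lattice becomes the column condition on \<open>T\<close>.
\<close>
lemma orthogonal_family_join:
  assumes "s \<in> carrier G" "\<And>i. i < k \<Longrightarrow> x i \<in> carrier G \<and> x i \<unlhd> s \<and> x i \<noteq> s"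
    and "\<And>i j. \<lbrakk>i < k; j < k; i \<noteq> j\<rbrakk> \<Longrightarrow> x i \<curlyvee> x j = s"
  shows "orthogonal_family G P k (\<lambda>i. inv (x i) \<otimes> s)"
  unfolding orthogonal_family_def
proof (intro conjI allI impI)
  fix i assume i: "i < k"
  then show "inv (x i) \<otimes> s \<in> P" using assms(2) by (simp add: cone_le_def)
  show "inv (x i) \<otimes> s \<noteq> \<one>"
    using assms(1) assms(2)[OF i] by (metis inv_closed inv_equality inv_inv)
  fix j assume j: "j < k" "i \<noteq> j"
  show "(inv (x i) \<otimes> s) \<curlywedge> (inv (x j) \<otimes> s) = \<one>"
  proof (rule cone_eqI_lower)
    fix z assume z: "z \<in> carrier G"
    have "z \<unlhd> (inv (x i) \<otimes> s) \<curlywedge> (inv (x j) \<otimes> s) \<longleftrightarrow> x i \<curlyvee> x j \<unlhd> s \<otimes> inv z"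
      using assms(1) assms(2)[OF i] assms(2)[OF j(1)] z
      by (simp add: le_cone_meet_iff cone_join_le_iff left_quotient_le_iff(2))
    also have "\<dots> \<longleftrightarrow> z \<unlhd> \<one>"
      using assms(3)[OF i j] left_quotient_le_iff(2)[of s s z] assms(1) z by simp
    finally show "z \<unlhd> (inv (x i) \<otimes> s) \<curlywedge> (inv (x j) \<otimes> s) \<longleftrightarrow> z \<unlhd> \<one>" .
  qed (use assms i j in \<open>simp_all add: cone_meet_closed\<close>)
qed

lemma orthogonal_family_meet:
  assumes "s \<in> carrier G" "\<And>i. i < k \<Longrightarrow> x i \<in> carrier G \<and> s \<unlhd> x i \<and> x i \<noteq> s"
    and "\<And>i j. \<lbrakk>i < k; j < k; i \<noteq> j\<rbrakk> \<Longrightarrow> x i \<curlywedge> x j = s"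
  shows "orthogonal_family G P k (\<lambda>i. inv s \<otimes> x i)"
  unfolding orthogonal_family_def
proof (intro conjI allI impI)
  fix i assume i: "i < k"
  then show "inv s \<otimes> x i \<in> P" using assms(2) by (simp add: cone_le_def)
  show "inv s \<otimes> x i \<noteq> \<one>"
    using assms(1) assms(2)[OF i] by (metis inv_closed inv_equality inv_inv)
  fix j assume j: "j < k" "i \<noteq> j"
  show "(inv s \<otimes> x i) \<curlywedge> (inv s \<otimes> x j) = \<one>"
  proof (rule cone_eqI_lower)
    fix z assume z: "z \<in> carrier G"
    have "z \<unlhd> (inv s \<otimes> x i) \<curlywedge> (inv s \<otimes> x j) \<longleftrightarrow> s \<otimes> z \<unlhd> x i \<curlywedge> x j"
      using assms(1) assms(2)[OF i] assms(2)[OF j(1)] z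
      by (simp add: le_cone_meet_iff left_quotient_le_iff(4))
    also have "\<dots> \<longleftrightarrow> z \<unlhd> \<one>"
      using assms(3)[OF i j] left_quotient_le_iff(4)[of s s z] assms(1) z by simp
    finally show "z \<unlhd> (inv s \<otimes> x i) \<curlywedge> (inv s \<otimes> x j) \<longleftrightarrow> z \<unlhd> \<one>" .
  qed (use assms i j in \<open>simp_all add: cone_meet_closed\<close>)
qed

lemma left_quotient_mult:
  "\<lbrakk>r \<in> carrier G; s \<in> carrier G; t \<in> carrier G\<rbrakk> \<Longrightarrow> (inv r \<otimes> s) \<otimes> (inv s \<otimes> t) = inv r \<otimes> t"
  by (simp add: m_assoc inv_solve_left') (simp flip: m_assoc)

section \<open>Regularity of contractive representations\<close>

text \<open>
  The operators are \<open>A r s = T(r\<^sup>-\<^sup>1 s)\<close> for \<open>r \<unlhd> s\<close>.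
\<close>
lemma column_contractive_imp_right_regular:
  fixes T :: "'a \<Rightarrow> ('h::complex_hilbert_space \<Rightarrow>\<^sub>L 'h)"
  assumes "representation G P T" and col: "column_contractive G P T"
  shows "right_regular G P T"
proof -
  have T: "\<And>p. p \<in> P \<Longrightarrow> T p \<in> bounded_operators" "T \<one> = id_blinfun"
    "\<And>p q. \<lbrakk>p \<in> P; q \<in> P\<rbrakk> \<Longrightarrow> T (p \<otimes> q) = T p o\<^sub>L T q"
    using assms(1) by (auto simp: representation_def)
  let ?S = "\<lambda>g. cadjoint (T (neg_part G P g)) o\<^sub>L T (pos_part G P g)"
  have S: "?S g \<in> bounded_operators" if "g \<in> carrier G" for g
    using that by (simp add: T pos_part_in_cone neg_part_in_cone compose_bounded_operators
        cadjoint_bounded_operators)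
  have "(\<Sum>i<n. cinner (\<Sum>j<n. ?S (inv (g i) \<otimes> g j) (h j)) (h i)) \<in> \<real>\<^sub>\<ge>\<^sub>0"
    if g: "\<And>i. i < n \<Longrightarrow> g i \<in> carrier G" for n g and h :: "nat \<Rightarrow> 'h"
  proof -
    define A where "A r s v = T (inv r \<otimes> s) v" for r s v
    have "(\<Sum>i<n. cinner (\<Sum>j<n. ?S (inv (g i) \<otimes> g j) (h j)) (h i))
        = (\<Sum>i<n. \<Sum>j<n. cinner (A (g i \<curlywedge> g j) (g j) (h j)) (A (g i \<curlywedge> g j) (g i) (h i)))"
      unfolding cinner_sum_left
    proof (intro sum.cong refl)
      fix i j assume "i \<in> {..<n}" "j \<in> {..<n}"
      then have ij: "g i \<in> carrier G" "g j \<in> carrier G" using g by auto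
      then have "T (neg_part G P (inv (g i) \<otimes> g j)) \<in> bounded_operators"
        by (simp add: T neg_part_in_cone)
      then show "cinner (?S (inv (g i) \<otimes> g j) (h j)) (h i)
          = cinner (A (g i \<curlywedge> g j) (g j) (h j)) (A (g i \<curlywedge> g j) (g i) (h i))"
        by (simp add: cinner_cadjoint_left A_def pos_part_left_quotient(1)[OF ij]
            neg_part_left_quotient(1)[OF ij])
    qed
    also have "\<dots> \<in> \<real>\<^sub>\<ge>\<^sub>0"
    proof (rule distrib_lattice_on.kernel_nonneg[OF cone_order_distrib_lattice])
      show "A r s (v + w) = A r s v + A r s w" for r s v w
        by (simp add: A_def blinfun.add_right)
      show "A r s (A s t v) = A r t v"
        if "r \<in> carrier G" "s \<in> carrier G" "t \<in> carrier G" "r \<unlhd> s" "s \<unlhd> t" for r s t v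
        using T(3)[of "inv r \<otimes> s" "inv s \<otimes> t"] that
        by (simp add: A_def cone_le_def left_quotient_mult)
      show "(\<Sum>i<k. (norm (A (x i) s v))\<^sup>2) \<le> (norm v)\<^sup>2"
        if "s \<in> carrier G" "\<And>i::nat. i < k \<Longrightarrow> x i \<in> carrier G \<and> x i \<unlhd> s \<and> x i \<noteq> s"
          "\<And>i j. \<lbrakk>i < k; j < k; i \<noteq> j\<rbrakk> \<Longrightarrow> x i \<curlyvee> x j = s" for s v and k :: nat and x
        unfolding A_def
      proof (rule sum_operator_le_id_imp_norm[where A = "\<lambda>i. T (inv (x i) \<otimes> s)"])
        have orth: "orthogonal_family G P k (\<lambda>i. inv (x i) \<otimes> s)"
          by (rule orthogonal_family_join[OF that])
        then show "operator_le (\<Sum>i<k. cadjoint (T (inv (x i) \<otimes> s)) o\<^sub>L T (inv (x i) \<otimes> s)) id_blinfun"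
          using col by (auto simp: column_contractive_def)
        show "T (inv (x i) \<otimes> s) \<in> bounded_operators" if "i < k" for i
          using orth that T(1) by (auto simp: orthogonal_family_def)
      qed
    qed (rule g)
    finally show ?thesis .
  qed
  then show ?thesis
    unfolding right_regular_def completely_positive_definite_def positive_operator_matrix_def
    using S by (auto simp: pos_part_one neg_part_one T(2) cadjoint_id intro: blinfun_eqI)
qed

text \<open>
  The order is reversed, and the operators are \<open>A r s = T(s\<^sup>-\<^sup>1 r)\<^sup>*\<close> for \<open>s \<unlhd> r\<close>: taking adjoints
  reverses products, and so does reversing the order.
\<close>
lemma row_contractive_imp_left_regular:
  fixes T :: "'a \<Rightarrow> ('h::complex_hilbert_space \<Rightarrow>\<^sub>L 'h)"
  assumes "representation G P T" and row: "row_contractive G P T"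
  shows "left_regular G P T"
proof -
  have T: "\<And>p. p \<in> P \<Longrightarrow> T p \<in> bounded_operators" "T \<one> = id_blinfun"
    "\<And>p q. \<lbrakk>p \<in> P; q \<in> P\<rbrakk> \<Longrightarrow> T (p \<otimes> q) = T p o\<^sub>L T q"
    using assms(1) by (auto simp: representation_def)
  let ?S = "\<lambda>g. T (pos_part G P g) o\<^sub>L cadjoint (T (neg_part G P g))"
  have S: "?S g \<in> bounded_operators" if "g \<in> carrier G" for g
    using that by (simp add: T pos_part_in_cone neg_part_in_cone compose_bounded_operators
        cadjoint_bounded_operators)
  have "(\<Sum>i<n. cinner (\<Sum>j<n. ?S (inv (g i) \<otimes> g j) (h j)) (h i)) \<in> \<real>\<^sub>\<ge>\<^sub>0"
    if g: "\<And>i. i < n \<Longrightarrow> g i \<in> carrier G" for n g and h :: "nat \<Rightarrow> 'h"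
  proof -
    define A where "A r s v = cadjoint (T (inv s \<otimes> r)) v" for r s v
    have "(\<Sum>i<n. cinner (\<Sum>j<n. ?S (inv (g i) \<otimes> g j) (h j)) (h i))
        = (\<Sum>i<n. \<Sum>j<n. cinner (A (g i \<curlyvee> g j) (g j) (h j)) (A (g i \<curlyvee> g j) (g i) (h i)))"
      unfolding cinner_sum_left
    proof (intro sum.cong refl)
      fix i j assume "i \<in> {..<n}" "j \<in> {..<n}"
      then have ij: "g i \<in> carrier G" "g j \<in> carrier G" using g by auto
      then have "T (pos_part G P (inv (g i) \<otimes> g j)) \<in> bounded_operators"
        by (simp add: T pos_part_in_cone)
      then show "cinner (?S (inv (g i) \<otimes> g j) (h j)) (h i)
          = cinner (A (g i \<curlyvee> g j) (g j) (h j)) (A (g i \<curlyvee> g j) (g i) (h i))"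
        by (simp add: cinner_cadjoint A_def pos_part_left_quotient(2)[OF ij]
            neg_part_left_quotient(2)[OF ij])
    qed
    also have "\<dots> \<in> \<real>\<^sub>\<ge>\<^sub>0"
    proof (rule distrib_lattice_on.kernel_nonneg[OF
          distrib_lattice_on.dual[OF cone_order_distrib_lattice]])
      show "A r s (v + w) = A r s v + A r s w" for r s v w
        by (simp add: A_def blinfun.add_right)
      show "A r s (A s t v) = A r t v"
        if "r \<in> carrier G" "s \<in> carrier G" "t \<in> carrier G" "s \<unlhd> r" "t \<unlhd> s" for r s t v
      proof -
        have "inv t \<otimes> s \<in> P" "inv s \<otimes> r \<in> P"
          using that by (simp_all add: cone_le_def)
        then have "cadjoint (T (inv t \<otimes> r)) = cadjoint (T (inv s \<otimes> r)) o\<^sub>L cadjoint (T (inv t \<otimes> s))"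
          using T(3)[of "inv t \<otimes> s" "inv s \<otimes> r"] that
          by (simp add: left_quotient_mult cadjoint_compose T(1))
        then show ?thesis by (simp add: A_def)
      qed
      show "(\<Sum>i<k. (norm (A (x i) s v))\<^sup>2) \<le> (norm v)\<^sup>2"
        if "s \<in> carrier G" "\<And>i::nat. i < k \<Longrightarrow> x i \<in> carrier G \<and> s \<unlhd> x i \<and> x i \<noteq> s"
          "\<And>i j. \<lbrakk>i < k; j < k; i \<noteq> j\<rbrakk> \<Longrightarrow> x i \<curlywedge> x j = s" for s v and k :: nat and x
        unfolding A_def
      proof (rule sum_operator_le_id_imp_norm[where A = "\<lambda>i. cadjoint (T (inv s \<otimes> x i))"])
        have orth: "orthogonal_family G P k (\<lambda>i. inv s \<otimes> x i)"
          by (rule orthogonal_family_meet[OF that])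
        then have B: "T (inv s \<otimes> x i) \<in> bounded_operators" if "i < k" for i
          using that T(1) by (auto simp: orthogonal_family_def)
        then show "cadjoint (T (inv s \<otimes> x i)) \<in> bounded_operators" if "i < k" for i
          using that by (simp add: cadjoint_bounded_operators)
        have "operator_le (\<Sum>i<k. T (inv s \<otimes> x i) o\<^sub>L cadjoint (T (inv s \<otimes> x i))) id_blinfun"
          using orth row by (auto simp: row_contractive_def)
        then show "operator_le (\<Sum>i<k. cadjoint (cadjoint (T (inv s \<otimes> x i))) o\<^sub>L
            cadjoint (T (inv s \<otimes> x i))) id_blinfun"
          using B by (simp add: cadjoint_cadjoint)
      qed
    qed (rule g)
    finally show ?thesis .
  qed
  then show ?thesis
    unfolding left_regular_def completely_positive_definite_def positive_operator_matrix_def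
    using S by (auto simp: pos_part_one neg_part_one T(2) cadjoint_id intro: blinfun_eqI)
qed

end

theorem theorem5p3:
  fixes G :: "('g, 'm) monoid_scheme" and P :: "'g set"
    and T :: "'g \<Rightarrow> ('h::complex_hilbert_space \<Rightarrow>\<^sub>L 'h)"
  assumes "lattice_ordered_group G P"
    and "contractive_representation G P T"
  shows "(column_contractive G P T \<longrightarrow> right_regular G P T) \<and>
         (row_contractive G P T \<longrightarrow> left_regular G P T)"
  using assms lattice_ordered_group.column_contractive_imp_right_regular
    lattice_ordered_group.row_contractive_imp_left_regular
  unfolding contractive_representation_def by blast

end
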